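(* Let $(A,p_l)$ be a Fréchet algebra which is either weakly amenable or has a bounded approximate identity. Then for each $n\in\mathbb{N}$, $A^{\#}$ is $n$-weakly amenable if and only if $A$ is $n$-weakly amenable.
   Context: All spaces are complex and $\mathbb{N}=\{1,2,\dots\}$. A Fréchet algebra $(A,p_l)$ is an algebra that is complete and Hausdorff for the topology generated by a separating, increasing sequence $(p_l)_{l\in\mathbb{N}}$ of submultiplicative seminorms. A bounded approximate identity is a bounded net $(e_\alpha)$ in $A$ with $e_\alpha a\to a$ and $ae_\alpha\to a$ for all $a\in A$. The unitization of $A$ is $A^{\#}=A\oplus\mathbb{C}e$ with product $(a,\lambda)(b,\mu)=(ab+\mu a+\lambda b,\lambda\mu)$ and seminorms $q_l(a,\lambda)=p_l(a)+|\lambda|$; it is a Fréchet algebra with identity $e=(0,1)$. For a locally convex space $X$, $X^*$ is its continuous dual with the strong topology (uniform convergence on bounded subsets of $X$); $X^{(0)}=X$ and $X^{(n)}=(X^{(n-1)})^*$. If $B$ is a Fréchet algebra and $X$ a locally convex $B$-bimodule, then $X^*$ is a $B$-bimodule via $\langle b\cdot f,x\rangle=\langle f,x\cdot b\rangle$ and $\langle f\cdot b,x\rangle=\langle f,b\cdot x\rangle$; iterating, every $X^{(n)}$ is a $B$-bimodule. $B$ is a bimodule over itself by multiplication. A continuous derivation $D:B\to X$ is a continuous linear map with $D(ab)=a\cdot D(b)+D(a)\cdot b$ for all $a,b\in B$; it is inner if there is $x\in X$ with $D(b)=b\cdot x-x\cdot b$ for all $b\in B$. $B$ is $n$-weakly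 amenable if every continuous derivation $B\to B^{(n)}$ is inner; weakly amenable means $1$-weakly amenable. *)

theory Defs
  imports "HOL-Analysis.Analysis" "HOL-Library.Function_Algebras"
begin

section \<open>Complex vector spaces and complex algebras\<close>

class scaleC =
  fixes scaleC :: "complex \<Rightarrow> 'a \<Rightarrow> 'a"  (infixr "*\<^sub>C" 75)

class complex_vector = scaleC + ab_group_add +
  assumes scaleC_add_right: "a *\<^sub>C (x + y) = a *\<^sub>C x + a *\<^sub>C y"
    and scaleC_add_left: "(a + b) *\<^sub>C x = a *\<^sub>C x + b *\<^sub>C x"
    and scaleC_scaleC [simp]: "a *\<^sub>C (b *\<^sub>C x) = (a * b) *\<^sub>C x"
    and scaleC_one [simp]: "1 *\<^sub>C x = x"

text \<open>Algebras are associative but not assumed to be commutative or unital.\<close>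

class complex_algebra = complex_vector + ring +
  assumes mult_scaleC_left: "(a *\<^sub>C x) * y = a *\<^sub>C (x * y)"
    and mult_scaleC_right: "x * (a *\<^sub>C y) = a *\<^sub>C (x * y)"

lemma scaleC_zero_left [simp]: "0 *\<^sub>C x = (0 :: 'a::complex_vector)"
  using scaleC_add_left[of 0 0 x] by simp

lemma scaleC_zero_right [simp]: "a *\<^sub>C 0 = (0 :: 'a::complex_vector)"
  using scaleC_add_right[of a 0 "0 :: 'a"] by simp

lemma scaleC_minus_one: "(- 1) *\<^sub>C x = - (x :: 'a::complex_vector)"
proof -
  have "(- 1) *\<^sub>C x + x = 0"
    using scaleC_add_left[of "- 1" 1 x] by simp
  then show ?thesis
    by (simp add: eq_neg_iff_add_eq_0)
qed

instantiation complex :: complex_algebra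
begin
definition scaleC_complex :: "complex \<Rightarrow> complex \<Rightarrow> complex" where
  scaleC_complex_def [simp]: "scaleC_complex a x = a * x"
instance by standard (auto simp: algebra_simps)
end

instantiation prod :: (complex_vector, complex_vector) complex_vector
begin
definition scaleC_prod :: "complex \<Rightarrow> 'a \<times> 'b \<Rightarrow> 'a \<times> 'b" where
  "scaleC_prod a x = (a *\<^sub>C fst x, a *\<^sub>C snd x)"
instance by standard (auto simp: scaleC_prod_def scaleC_add_left scaleC_add_right)
end

instantiation "fun" :: (type, complex_vector) complex_vector
begin
definition scaleC_fun :: "complex \<Rightarrow> ('a \<Rightarrow> 'b) \<Rightarrow> 'a \<Rightarrow> 'b" where
  "scaleC_fun a f = (\<lambda>x. a *\<^sub>C f x)"
instance by standard (auto simp: scaleC_fun_def scaleC_add_left scaleC_add_right)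
end

definition clinear_on :: "'x::complex_vector set \<Rightarrow> ('x \<Rightarrow> 'y::complex_vector) \<Rightarrow> bool" where
  "clinear_on S f \<longleftrightarrow>
     (\<forall>x\<in>S. \<forall>y\<in>S. f (x + y) = f x + f y) \<and> (\<forall>c. \<forall>x\<in>S. f (c *\<^sub>C x) = c *\<^sub>C f x)"


section \<open>Unitization\<close>

datatype 'a unitization = Unitization (algebra_part: 'a) (scalar_part: complex)

instantiation unitization :: (complex_algebra) complex_algebra
begin

definition zero_unitization :: "'a unitization" where
  "0 = Unitization 0 0"
definition plus_unitization :: "'a unitization \<Rightarrow> 'a unitization \<Rightarrow> 'a unitization" where
  "x + y = Unitization (algebra_part x + algebra_part y) (scalar_part x + scalar_part y)"
definition minus_unitization :: "'a unitization \<Rightarrow> 'a unitization \<Rightarrow> 'a unitization" where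
  "x - y = Unitization (algebra_part x - algebra_part y) (scalar_part x - scalar_part y)"
definition uminus_unitization :: "'a unitization \<Rightarrow> 'a unitization" where
  "- x = Unitization (- algebra_part x) (- scalar_part x)"
definition scaleC_unitization :: "complex \<Rightarrow> 'a unitization \<Rightarrow> 'a unitization" where
  "c *\<^sub>C x = Unitization (c *\<^sub>C algebra_part x) (c * scalar_part x)"
definition times_unitization :: "'a unitization \<Rightarrow> 'a unitization \<Rightarrow> 'a unitization" where
  "x * y = Unitization
     (algebra_part x * algebra_part y + scalar_part y *\<^sub>C algebra_part x
        + scalar_part x *\<^sub>C algebra_part y)
     (scalar_part x * scalar_part y)"

instance
  by standard
    (auto simp: zero_unitization_def plus_unitization_def minus_unitization_def
      uminus_unitization_def scaleC_unitization_def times_unitization_def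
      unitization.expand algebra_simps scaleC_add_left scaleC_add_right
      mult_scaleC_left mult_scaleC_right)

end

instantiation unitization :: (complex_algebra) ring_1
begin
definition one_unitization :: "'a unitization" where
  "1 = Unitization 0 1"
instance
  by standard (auto simp: one_unitization_def zero_unitization_def times_unitization_def)
end

definition unitization_seminorms ::
  "(nat \<Rightarrow> 'a \<Rightarrow> real) \<Rightarrow> nat \<Rightarrow> 'a unitization \<Rightarrow> real" where
  "unitization_seminorms p l x = p l (algebra_part x) + cmod (scalar_part x)"


section \<open>Topologies given by seminorms; Frechet algebras\<close>

definition seminorm_topology :: "'x::complex_vector set \<Rightarrow> ('x \<Rightarrow> real) set \<Rightarrow> 'x topology" where
  "seminorm_topology S P =
     topology_generated_by (insert S {{y \<in> S. q (y - x) < r} | q x r. q \<in> P \<and> x \<in> S \<and> 0 < r})"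

text \<open>Von Neumann boundedness.\<close>

definition tvs_bounded :: "'x::complex_vector topology \<Rightarrow> 'x set \<Rightarrow> bool" where
  "tvs_bounded T B \<longleftrightarrow> B \<subseteq> topspace T \<and>
     (\<forall>U. openin T U \<and> 0 \<in> U \<longrightarrow> (\<exists>s>0. \<forall>t>s. B \<subseteq> scaleC (complex_of_real t) ` U))"

definition frechet_topology :: "(nat \<Rightarrow> 'a::complex_vector \<Rightarrow> real) \<Rightarrow> 'a topology" where
  "frechet_topology p = seminorm_topology UNIV (range p)"

text \<open>The seminorms are indexed from 0 instead of 1. The topology is metrizable, so that
  completeness is expressed by Cauchy sequences.\<close>

definition frechet_algebra :: "(nat \<Rightarrow> 'a::complex_algebra \<Rightarrow> real) \<Rightarrow> bool" where
  "frechet_algebra p \<longleftrightarrow>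
     (\<forall>l x y. p l (x + y) \<le> p l x + p l y) \<and>
     (\<forall>l c x. p l (c *\<^sub>C x) = cmod c * p l x) \<and>
     (\<forall>l x y. p l (x * y) \<le> p l x * p l y) \<and>
     (\<forall>l x. p l x \<le> p (Suc l) x) \<and>
     (\<forall>x. (\<forall>l. p l x = 0) \<longrightarrow> x = 0) \<and>
     (\<forall>X :: nat \<Rightarrow> 'a.
        (\<forall>l. \<forall>e>0. \<exists>N. \<forall>i\<ge>N. \<forall>j\<ge>N. p l (X i - X j) < e) \<longrightarrow>
        (\<exists>x. limitin (frechet_topology p) X x sequentially))"

text \<open>A net is represented by the filter of its tails on the algebra, i.e. the image of the
  at-infinity filter of its directed index set; conversely every proper filter on the algebra is
  the tail filter of a net. That the net is bounded becomes: some bounded set belongs to the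
  filter.\<close>

definition has_bounded_approximate_identity ::
  "(nat \<Rightarrow> 'a::complex_algebra \<Rightarrow> real) \<Rightarrow> bool" where
  "has_bounded_approximate_identity p \<longleftrightarrow>
     (\<exists>F :: 'a filter. F \<noteq> bot \<and>
        (\<exists>B. tvs_bounded (frechet_topology p) B \<and> eventually (\<lambda>e. e \<in> B) F) \<and>
        (\<forall>a. limitin (frechet_topology p) (\<lambda>e. e * a) a F \<and>
             limitin (frechet_topology p) (\<lambda>e. a * e) a F))"


section \<open>Locally convex bimodules and their strong duals\<close>

text \<open>A bimodule over an algebra of type 'b. Its carrier is the topspace of its topology, a
  subspace of the ambient vector space 'x. The operations and the topology are only
  meaningful on the carrier.\<close>

record ('b, 'x) lc_bimodule =
  lcb_topology :: "'x topology"
  lact :: "'b \<Rightarrow> 'x \<Rightarrow> 'x"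
  ract :: "'x \<Rightarrow> 'b \<Rightarrow> 'x"

abbreviation lcb_space :: "('b, 'x) lc_bimodule \<Rightarrow> 'x set" where
  "lcb_space M \<equiv> topspace (lcb_topology M)"

definition regular_bimodule ::
  "(nat \<Rightarrow> 'b::complex_algebra \<Rightarrow> real) \<Rightarrow> ('b, 'b) lc_bimodule" where
  "regular_bimodule p =
     \<lparr>lcb_topology = frechet_topology p, lact = (\<lambda>b x. b * x), ract = (\<lambda>x b. x * b)\<rparr>"

text \<open>Functionals are extended by 0 outside the carrier, which makes them unique.\<close>

definition continuous_dual :: "'x::complex_vector topology \<Rightarrow> ('x \<Rightarrow> complex) set" where
  "continuous_dual T =
     {f. clinear_on (topspace T) f \<and> continuous_map T euclidean f \<and>
         (\<forall>x. x \<notin> topspace T \<longrightarrow> f x = 0)}"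

text \<open>The inserted point 0 only serves to make the supremum 0 if B is empty.\<close>

definition dual_seminorm :: "'x::complex_vector set \<Rightarrow> ('x \<Rightarrow> complex) \<Rightarrow> real" where
  "dual_seminorm B f = (SUP x\<in>insert 0 B. cmod (f x))"

definition strong_topology :: "'x::complex_vector topology \<Rightarrow> ('x \<Rightarrow> complex) topology" where
  "strong_topology T =
     seminorm_topology (continuous_dual T) {dual_seminorm B | B. tvs_bounded T B}"

definition dual_bimodule ::
  "('b, 'x::complex_vector) lc_bimodule \<Rightarrow> ('b, 'x \<Rightarrow> complex) lc_bimodule" where
  "dual_bimodule M =
     \<lparr>lcb_topology = strong_topology (lcb_topology M),
      lact = (\<lambda>b f x. if x \<in> lcb_space M then f (ract M x b) else 0),
      ract = (\<lambda>f b x. if x \<in> lcb_space M then f (lact M b x) else 0)\<rparr>"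

definition lcb_iso ::
  "('x \<Rightarrow> 'y) \<Rightarrow> ('b, 'x::complex_vector) lc_bimodule \<Rightarrow> ('b, 'y::complex_vector) lc_bimodule \<Rightarrow> bool"
  where
  "lcb_iso \<phi> M N \<longleftrightarrow>
     homeomorphic_map (lcb_topology M) (lcb_topology N) \<phi> \<and>
     clinear_on (lcb_space M) \<phi> \<and>
     (\<forall>b. \<forall>x\<in>lcb_space M. \<phi> (lact M b x) = lact N b (\<phi> x) \<and> \<phi> (ract M x b) = ract N (\<phi> x) b)"

definition lcb_isomorphic ::
  "('b, 'x::complex_vector) lc_bimodule \<Rightarrow> ('b, 'y::complex_vector) lc_bimodule \<Rightarrow> bool" where
  "lcb_isomorphic M N \<longleftrightarrow> (\<exists>\<phi>. lcb_iso \<phi> M N)"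


section \<open>Iterated duals and n-weak amenability\<close>

text \<open>The strong dual of a bimodule over the type 'x lives over the type
  \<open>'x \<Rightarrow> complex\<close>, so the n-th dual for a variable n has no fixed type. Therefore the
  spaces of the tower of iterated duals are represented, up to isomorphism of locally convex
  bimodules, inside one ambient vector space 'u. The predicate \<open>iterated_dual p n M\<close> says that
  M is a copy of the n-th dual of the regular bimodule, obtained through copies in 'u of
  all lower duals. Below it is shown that copies are unique up to isomorphism, even across
  ambient spaces, and that for every n some ambient space has a copy.\<close>

primrec iterated_dual ::
  "(nat \<Rightarrow> 'b::complex_algebra \<Rightarrow> real) \<Rightarrow> nat \<Rightarrow> ('b, 'u::complex_vector) lc_bimodule \<Rightarrow> bool"
  where
  "iterated_dual p 0 M \<longleftrightarrow> lcb_isomorphic (regular_bimodule p) M"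
| "iterated_dual p (Suc n) M \<longleftrightarrow>
     (\<exists>M' :: ('b, 'u) lc_bimodule. iterated_dual p n M' \<and> lcb_isomorphic (dual_bimodule M') M)"

definition has_iterated_dual ::
  "'u::complex_vector itself \<Rightarrow> nat \<Rightarrow> (nat \<Rightarrow> 'b::complex_algebra \<Rightarrow> real) \<Rightarrow> bool" where
  "has_iterated_dual U n p \<longleftrightarrow> (\<exists>M :: ('b, 'u) lc_bimodule. iterated_dual p n M)"

definition continuous_derivation ::
  "(nat \<Rightarrow> 'b::complex_algebra \<Rightarrow> real) \<Rightarrow> ('b, 'x::complex_vector) lc_bimodule \<Rightarrow> ('b \<Rightarrow> 'x) \<Rightarrow> bool"
  where
  "continuous_derivation p M D \<longleftrightarrow>
     clinear_on UNIV D \<and> continuous_map (frechet_topology p) (lcb_topology M) D \<and>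
     (\<forall>a b. D (a * b) = lact M a (D b) + ract M (D a) b)"

definition inner_derivation ::
  "('b, 'x::complex_vector) lc_bimodule \<Rightarrow> ('b \<Rightarrow> 'x) \<Rightarrow> bool" where
  "inner_derivation M D \<longleftrightarrow> (\<exists>x\<in>lcb_space M. \<forall>b. D b = lact M b x - ract M x b)"

text \<open>Meaningful under \<open>has_iterated_dual U n p\<close>; the choice of U and of the copy M
  is then immaterial.\<close>

definition n_weakly_amenable ::
  "'u::complex_vector itself \<Rightarrow> nat \<Rightarrow> (nat \<Rightarrow> 'b::complex_algebra \<Rightarrow> real) \<Rightarrow> bool" where
  "n_weakly_amenable U n p \<longleftrightarrow>
     (\<forall>M :: ('b, 'u) lc_bimodule. iterated_dual p n M \<longrightarrow>
        (\<forall>D. continuous_derivation p M D \<longrightarrow> inner_derivation M D))"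

abbreviation weakly_amenable ::
  "'u::complex_vector itself \<Rightarrow> (nat \<Rightarrow> 'b::complex_algebra \<Rightarrow> real) \<Rightarrow> bool" where
  "weakly_amenable U p \<equiv> n_weakly_amenable U 1 p"

section \<open>Existence and uniqueness of the copies of the iterated duals\<close>

lemma clinear_onD:
  assumes "clinear_on S f"
  shows "x \<in> S \<Longrightarrow> y \<in> S \<Longrightarrow> f (x + y) = f x + f y"
    and "x \<in> S \<Longrightarrow> f (c *\<^sub>C x) = c *\<^sub>C f x"
  using assms by (auto simp: clinear_on_def)

definition csubspace_set :: "'x::complex_vector set \<Rightarrow> bool" where
  "csubspace_set S \<longleftrightarrow> 0 \<in> S \<and> (\<forall>x\<in>S. \<forall>y\<in>S. x + y \<in> S) \<and> (\<forall>c. \<forall>x\<in>S. c *\<^sub>C x \<in> S)"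

lemma csubspace_setD:
  assumes "csubspace_set S"
  shows "0 \<in> S" "x \<in> S \<Longrightarrow> y \<in> S \<Longrightarrow> x + y \<in> S" "x \<in> S \<Longrightarrow> c *\<^sub>C x \<in> S"
    "x \<in> S \<Longrightarrow> y \<in> S \<Longrightarrow> x - y \<in> S"
proof -
  show *: "0 \<in> S" "x \<in> S \<Longrightarrow> y \<in> S \<Longrightarrow> x + y \<in> S" "x \<in> S \<Longrightarrow> c *\<^sub>C x \<in> S" for x y c
    using assms by (auto simp: csubspace_set_def)
  show "x \<in> S \<Longrightarrow> y \<in> S \<Longrightarrow> x - y \<in> S"
    using *(2)[of x "(-1) *\<^sub>C y"] *(3)[of y "-1"] by (simp add: scaleC_minus_one)
qed

lemma clinear_on_diff:
  assumes "clinear_on S f" "csubspace_set S" "x \<in> S" "y \<in> S"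
  shows "f (x - y) = f x - f y"
proof -
  have "f (x + (-1) *\<^sub>C y) = f x + (-1) *\<^sub>C f y"
    using assms by (simp add: clinear_onD csubspace_setD del: scaleC_complex_def)
  then show ?thesis by (simp only: scaleC_minus_one) simp
qed

lemma clinear_on_zero:
  assumes "clinear_on S f" "csubspace_set S"
  shows "f 0 = 0"
  using clinear_onD(2)[OF assms(1) csubspace_setD(1)[OF assms(2)], of 0]
    csubspace_setD[OF assms(2)] by simp

text \<open>The conditions on a bimodule that are preserved along the tower.\<close>

definition wf_bimodule :: "('b, 'x::complex_vector) lc_bimodule \<Rightarrow> bool" where
  "wf_bimodule M \<longleftrightarrow> csubspace_set (lcb_space M) \<and>
     (\<forall>b. clinear_on (lcb_space M) (lact M b) \<and>
          continuous_map (lcb_topology M) (lcb_topology M) (lact M b) \<and>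
          clinear_on (lcb_space M) (\<lambda>x. ract M x b) \<and>
          continuous_map (lcb_topology M) (lcb_topology M) (\<lambda>x. ract M x b))"

lemma topspace_seminorm_topology [simp]: "topspace (seminorm_topology S P) = S"
  by (auto simp: seminorm_topology_def)

lemma topspace_frechet_topology [simp]: "topspace (frechet_topology p) = UNIV"
  by (simp add: frechet_topology_def)

lemma topspace_strong_topology [simp]: "topspace (strong_topology T) = continuous_dual T"
  by (simp add: strong_topology_def)

lemma openin_seminorm_ball:
  "q \<in> P \<Longrightarrow> x \<in> S \<Longrightarrow> 0 < r \<Longrightarrow> openin (seminorm_topology S P) {y \<in> S. q (y - x) < r}"
  unfolding seminorm_topology_def by (rule topology_generated_by_Basis) blast

lemma continuous_map_seminorm_topology:
  assumes S: "\<And>x. x \<in> S \<Longrightarrow> g x \<in> S'"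
    and tri: "\<And>q x y z. q \<in> P' \<Longrightarrow> x \<in> S' \<Longrightarrow> y \<in> S' \<Longrightarrow> z \<in> S' \<Longrightarrow> q (x - z) \<le> q (x - y) + q (y - z)"
    and zero: "\<And>q. q \<in> P \<Longrightarrow> q 0 = 0"
    and bnd: "\<And>q. q \<in> P' \<Longrightarrow> \<exists>q'\<in>P. \<exists>C>0. \<forall>x\<in>S. \<forall>y\<in>S. q (g x - g y) \<le> C * q' (x - y)"
  shows "continuous_map (seminorm_topology S P) (seminorm_topology S' P') g"
proof -
  have "openin (seminorm_topology S P) (g -` U \<inter> S)"
    if U: "U \<in> insert S' {{y \<in> S'. q (y - x) < r} | q x r. q \<in> P' \<and> x \<in> S' \<and> 0 < r}" for U
  proof (cases "U = S'")
    case True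
    then have "g -` U \<inter> S = S" using S by auto
    then show ?thesis by (metis openin_topspace topspace_seminorm_topology)
  next
    case False
    then obtain q z r where q: "q \<in> P'" "z \<in> S'" "0 < r" "U = {y \<in> S'. q (y - z) < r}"
      using U by auto
    obtain q' C where q': "q' \<in> P" "C > 0" "\<And>x y. x \<in> S \<Longrightarrow> y \<in> S \<Longrightarrow> q (g x - g y) \<le> C * q' (x - y)"
      using bnd[OF q(1)] by blast
    show ?thesis
    proof (subst openin_subopen, intro ballI)
      fix y assume y: "y \<in> g -` U \<inter> S"
      define e where "e = (r - q (g y - z)) / C"
      have e: "e > 0" using y q q'(2) by (auto simp: e_def)
      have "{x \<in> S. q' (x - y) < e} \<subseteq> g -` U \<inter> S"
      proof
        fix x assume x: "x \<in> {x \<in> S. q' (x - y) < e}"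
        have "q (g x - z) \<le> q (g x - g y) + q (g y - z)"
          using tri[OF q(1)] x y S q(2) by auto
        also have "q (g x - g y) \<le> C * q' (x - y)" using q'(3) x y by auto
        also have "C * q' (x - y) < C * e" using x q'(2) by auto
        also have "C * e = r - q (g y - z)" using q'(2) by (simp add: e_def)
        finally show "x \<in> g -` U \<inter> S" using x S q by auto
      qed
      then show "\<exists>T. openin (seminorm_topology S P) T \<and> y \<in> T \<and> T \<subseteq> g -` U \<inter> S"
        using openin_seminorm_ball[OF q'(1) _ e, of y S] y e zero[OF q'(1)] by auto
    qed
  qed
  then show ?thesis
    unfolding seminorm_topology_def[of S' P']
    by (intro continuous_on_generated_topo) (use S in auto)
qed

lemma frechet_algebraD:
  assumes "frechet_algebra p"
  shows "p l (x + y) \<le> p l x + p l y" "p l (c *\<^sub>C x) = cmod c * p l x"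
    "p l (x * y) \<le> p l x * p l y" "p l x \<le> p (Suc l) x" "p l 0 = 0" "0 \<le> p l x"
    "p l (x - z) \<le> p l (x - y) + p l (y - z)"
proof -
  show *: "p l (x + y) \<le> p l x + p l y" "p l (c *\<^sub>C x) = cmod c * p l x"
    "p l (x * y) \<le> p l x * p l y" "p l x \<le> p (Suc l) x" for x y l c
    using assms by (simp_all add: frechet_algebra_def)
  show z: "p l 0 = 0" using *(2)[of l 0 0] by simp
  show "0 \<le> p l x"
    using *(1)[of l x "(-1) *\<^sub>C x"] *(2)[of l "-1" x] z by (simp add: scaleC_minus_one)
  show "p l (x - z) \<le> p l (x - y) + p l (y - z)"
    using *(1)[of l "x - y" "y - z"] by simp
qed

lemma limitin_frechet_topology:
  assumes p: "\<And>l x y z. p l (x - z) \<le> p l (x - y) + p l (y - z)" "\<And>l. p l 0 = (0 :: real)"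
  shows "limitin (frechet_topology p) f x F \<longleftrightarrow>
    (\<forall>l. \<forall>e>0. eventually (\<lambda>i. p l (f i - x) < e) F)"
proof
  assume lim: "limitin (frechet_topology p) f x F"
  show "\<forall>l. \<forall>e>0. eventually (\<lambda>i. p l (f i - x) < e) F"
  proof (intro allI impI)
    fix l and e :: real assume e: "e > 0"
    have "openin (frechet_topology p) {y \<in> UNIV. p l (y - x) < e}"
      unfolding frechet_topology_def by (rule openin_seminorm_ball) (use e in auto)
    then show "eventually (\<lambda>i. p l (f i - x) < e) F"
      using lim e p(2) by (auto simp: limitin_def)
  qed
next
  assume ev: "\<forall>l. \<forall>e>0. eventually (\<lambda>i. p l (f i - x) < e) F"
  have "eventually (\<lambda>i. f i \<in> U) F"
    if "generate_topology_on (insert UNIV {{y \<in> UNIV. q (y - z) < r} | q z r. q \<in> range p \<and> z \<in> UNIV \<and> 0 < r}) U"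
      "x \<in> U" for U
    using that
  proof (induction rule: generate_topology_on.induct)
    case (Int a b)
    then show ?case by (auto intro: eventually_conj)
  next
    case (UN K)
    then obtain k where k: "k \<in> K" "x \<in> k" by auto
    show ?case by (rule eventually_mono[OF UN.IH[OF k]]) (use k in auto)
  next
    case (Basis b)
    show ?case
    proof (cases "b = UNIV")
      case False
      then obtain l z r where b: "b = {y. p l (y - z) < r}" using Basis(1) by auto
      then have "r - p l (x - z) > 0" using Basis(2) by auto
      from ev[rule_format, OF this, of l] show ?thesis
      proof (rule eventually_mono)
        fix i assume "p l (f i - x) < r - p l (x - z)"
        then show "f i \<in> b" using p(1)[of l "f i" z x] by (auto simp: b)
      qed
    qed auto
  qed auto
  then show "limitin (frechet_topology p) f x F"
    unfolding limitin_def
    by (auto simp: frechet_topology_def seminorm_topology_def openin_topology_generated_by_iff)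
qed

lemma frechet_algebra_unitization:
  fixes p :: "nat \<Rightarrow> 'a::complex_algebra \<Rightarrow> real"
  assumes p: "frechet_algebra p"
  shows "frechet_algebra (unitization_seminorms p)"
proof -
  let ?q = "unitization_seminorms p"
  have pc: "p l (c *\<^sub>C x) = cmod c * p l x" and padd: "p l (x + y) \<le> p l x + p l y"
    and pm: "p l (x * y) \<le> p l x * p l y" and pn: "0 \<le> p l x" for l c x y
    using frechet_algebraD[OF p] by auto
  have add: "?q l (x + y) \<le> ?q l x + ?q l y" for l x y
    using padd[of l "algebra_part x" "algebra_part y"]
      norm_triangle_ineq[of "scalar_part x" "scalar_part y"]
    by (simp add: unitization_seminorms_def plus_unitization_def)
  have mult: "?q l (x * y) \<le> ?q l x * ?q l y" for l x y
  proof -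
    let ?a = "algebra_part x" and ?b = "algebra_part y" and ?c = "scalar_part x" and ?d = "scalar_part y"
    have "p l (?a * ?b + ?d *\<^sub>C ?a + ?c *\<^sub>C ?b) \<le> p l ?a * p l ?b + cmod ?d * p l ?a + cmod ?c * p l ?b"
      using padd[of l "?a * ?b + ?d *\<^sub>C ?a" "?c *\<^sub>C ?b"] padd[of l "?a * ?b" "?d *\<^sub>C ?a"]
        pm[of l ?a ?b] by (simp add: pc)
    then show ?thesis
      by (simp add: unitization_seminorms_def times_unitization_def norm_mult algebra_simps)
  qed
  have tri: "?q l (x - z) \<le> ?q l (x - y) + ?q l (y - z)" for l x y z
    using add[of l "x - y" "y - z"] by simp
  have q0: "?q l 0 = 0" for l
    using frechet_algebraD(5)[OF p] by (simp add: unitization_seminorms_def zero_unitization_def)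
  have sep: "x = 0" if "\<forall>l. ?q l x = 0" for x
  proof -
    have "p l (algebra_part x) = 0 \<and> cmod (scalar_part x) = 0" for l
      using that pn[of l "algebra_part x"] norm_ge_zero[of "scalar_part x"]
      unfolding unitization_seminorms_def by (smt (verit))
    then have "algebra_part x = 0" "scalar_part x = 0"
      using p unfolding frechet_algebra_def by auto
    then show ?thesis by (simp add: zero_unitization_def unitization.expand)
  qed
  have compl: "\<exists>x. limitin (frechet_topology ?q) X x sequentially"
    if X: "\<forall>l. \<forall>e>0. \<exists>N. \<forall>i\<ge>N. \<forall>j\<ge>N. ?q l (X i - X j) < e" for X :: "nat \<Rightarrow> 'a unitization"
  proof -
    have le: "p l (algebra_part x - algebra_part y) \<le> ?q l (x - y)"
      "dist (scalar_part x) (scalar_part y) \<le> ?q l (x - y)" for l x y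
      using pn by (auto simp: unitization_seminorms_def minus_unitization_def dist_norm)
    have ca: "\<forall>l. \<forall>e>0. \<exists>N. \<forall>i\<ge>N. \<forall>j\<ge>N. p l (algebra_part (X i) - algebra_part (X j)) < e"
      using X le(1) by (meson order_le_less_trans)
    have cp: "\<And>Y :: nat \<Rightarrow> 'a. \<forall>l. \<forall>e>0. \<exists>N. \<forall>i\<ge>N. \<forall>j\<ge>N. p l (Y i - Y j) < e \<Longrightarrow>
        \<exists>x. limitin (frechet_topology p) Y x sequentially"
      using p by (simp add: frechet_algebra_def)
    obtain a where a: "limitin (frechet_topology p) (\<lambda>i. algebra_part (X i)) a sequentially"
      using cp[OF ca] by (elim exE)
    have "Cauchy (\<lambda>i. scalar_part (X i))"
      unfolding Cauchy_def using X le(2) by (meson order_le_less_trans)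
    then obtain c where c: "(\<lambda>i. scalar_part (X i)) \<longlonglongrightarrow> c"
      using Cauchy_convergent convergent_def by blast
    have "eventually (\<lambda>i. ?q l (X i - Unitization a c) < e) sequentially" if "e > 0" for l e
    proof -
      have 1: "eventually (\<lambda>i. p l (algebra_part (X i) - a) < e / 2) sequentially"
        using a that unfolding limitin_frechet_topology[OF frechet_algebraD(7,5)[OF p]]
        using half_gt_zero by blast
      have 2: "eventually (\<lambda>i. dist (scalar_part (X i)) c < e / 2) sequentially"
        using c that by (intro tendstoD) auto
      show ?thesis
        using 1 2 by eventually_elim
          (simp add: unitization_seminorms_def minus_unitization_def dist_norm)
    qed
    then show ?thesis unfolding limitin_frechet_topology[OF tri q0] by blast
  qed
  have scal: "?q l (c *\<^sub>C x) = cmod c * ?q l x" for l c x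
    by (simp add: unitization_seminorms_def scaleC_unitization_def pc norm_mult algebra_simps)
  have incr: "?q l x \<le> ?q (Suc l) x" for l x
    using frechet_algebraD(4)[OF p] by (simp add: unitization_seminorms_def)
  show ?thesis
    unfolding frechet_algebra_def
    by (intro conjI allI impI; (rule add scal mult incr sep compl)?; assumption?)
qed

lemma wf_regular_bimodule:
  assumes p: "frechet_algebra p"
  shows "wf_bimodule (regular_bimodule p)"
proof -
  have 1: "continuous_map (frechet_topology p) (frechet_topology p) g"
    if "\<And>l x y. p l (g x - g y) \<le> p l b * p l (x - y)" for b g
    unfolding frechet_topology_def
  proof (rule continuous_map_seminorm_topology)
    fix q assume "q \<in> range p"
    then obtain l where l: "q = p l" by auto
    have "p l (g x - g y) \<le> (p l b + 1) * p l (x - y)" for x y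
      using that[of l x y] frechet_algebraD(6)[OF p, of l "x - y"] by (simp add: algebra_simps)
    moreover have "p l b + 1 > 0" using frechet_algebraD(6)[OF p, of l b] by simp
    ultimately show "\<exists>q'\<in>range p. \<exists>C>0. \<forall>x\<in>UNIV. \<forall>y\<in>UNIV. q (g x - g y) \<le> C * q' (x - y)"
      unfolding l by blast
  qed (use frechet_algebraD[OF p] in auto)
  have "p l (b * x - b * y) \<le> p l b * p l (x - y)" "p l (x * b - y * b) \<le> p l b * p l (x - y)"
    for l b x y
    using frechet_algebraD(3)[OF p, of l b "x - y"] frechet_algebraD(3)[OF p, of l "x - y" b]
    by (simp_all add: algebra_simps)
  then have "continuous_map (frechet_topology p) (frechet_topology p) (\<lambda>x. b * x)"
    "continuous_map (frechet_topology p) (frechet_topology p) (\<lambda>x. x * b)" for b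
    by (auto intro!: 1[where b = b])
  then show ?thesis
    by (auto simp: wf_bimodule_def regular_bimodule_def csubspace_set_def clinear_on_def
        distrib_left distrib_right mult_scaleC_left mult_scaleC_right)
qed

lemma tvs_bounded_image:
  assumes "tvs_bounded T B" "continuous_map T T' g" "clinear_on (topspace T) g"
    "csubspace_set (topspace T)"
  shows "tvs_bounded T' (g ` B)"
  unfolding tvs_bounded_def
proof (intro conjI allI impI)
  show "g ` B \<subseteq> topspace T'"
    using assms by (auto simp: tvs_bounded_def continuous_map_def)
  fix U assume U: "openin T' U \<and> 0 \<in> U"
  have "openin T {x \<in> topspace T. g x \<in> U}" using assms(2) U by (auto simp: continuous_map_def)
  moreover have "0 \<in> {x \<in> topspace T. g x \<in> U}"
    using clinear_on_zero[OF assms(3,4)] U csubspace_setD(1)[OF assms(4)] by auto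
  ultimately obtain s where s: "s > 0"
    "\<And>t. t > s \<Longrightarrow> B \<subseteq> scaleC (complex_of_real t) ` {x \<in> topspace T. g x \<in> U}"
    using assms(1) unfolding tvs_bounded_def by blast
  have "g ` B \<subseteq> scaleC (complex_of_real t) ` U" if "t > s" for t
    using s(2)[OF that] clinear_onD(2)[OF assms(3)] by fastforce
  then show "\<exists>s>0. \<forall>t>s. g ` B \<subseteq> scaleC (complex_of_real t) ` U" using s(1) by blast
qed

lemma continuous_dual_0 [simp]: "0 \<in> continuous_dual T"
  by (auto simp: continuous_dual_def clinear_on_def zero_fun_def)

lemma csubspace_set_continuous_dual: "csubspace_set (continuous_dual T)"
proof -
  have "continuous_map T euclidean (\<lambda>x. f x + g x)" "continuous_map T euclidean (\<lambda>x. c * f x)"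
    if "continuous_map T euclidean f" "continuous_map T euclidean g"
    for f g :: "'a \<Rightarrow> complex" and c
  proof -
    show "continuous_map T euclidean (\<lambda>x. f x + g x)" by (intro continuous_map_add that)
    have "continuous_map euclidean euclidean (\<lambda>x. c * x)"
      by (simp add: continuous_on_mult_left)
    then show "continuous_map T euclidean (\<lambda>x. c * f x)"
      using continuous_map_compose[OF that(1), of euclidean "\<lambda>x. c * x"] by (simp add: o_def)
  qed
  then show ?thesis
    unfolding csubspace_set_def
    by (auto simp: continuous_dual_def clinear_on_def plus_fun_def scaleC_fun_def zero_fun_def
        algebra_simps)
qed

lemma bdd_above_dual:
  assumes "tvs_bounded T B" "f \<in> continuous_dual T" "csubspace_set (topspace T)"
  shows "bdd_above ((\<lambda>x. cmod (f x)) ` insert 0 B)"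
proof -
  have f: "clinear_on (topspace T) f" "continuous_map T euclidean f"
    using assms(2) by (auto simp: continuous_dual_def)
  have "tvs_bounded euclidean (f ` B)" by (rule tvs_bounded_image[OF assms(1) f(2,1) assms(3)])
  moreover have "openin euclidean (ball 0 1 :: complex set)" "0 \<in> (ball 0 1 :: complex set)" by auto
  ultimately obtain s where s: "s > 0"
    "\<And>t. t > s \<Longrightarrow> f ` B \<subseteq> scaleC (complex_of_real t) ` ball 0 1"
    unfolding tvs_bounded_def by blast
  have "cmod (f x) \<le> s + 1" if "x \<in> B" for x
  proof -
    have "f x \<in> scaleC (complex_of_real (s + 1)) ` ball 0 1"
      using s(2)[of "s + 1"] that by (simp add: subset_iff)
    then obtain y where y: "f x = complex_of_real (s + 1) * y" "cmod y < 1"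
      unfolding image_iff scaleC_complex_def by (metis mem_ball_0)
    have "cmod (f x) = (s + 1) * cmod y" unfolding y(1) norm_mult norm_of_real using s(1) by simp
    also have "\<dots> \<le> (s + 1) * 1" using y(2) s(1) by (intro mult_left_mono) auto
    finally show ?thesis by simp
  qed
  moreover have "cmod (f 0) \<le> s + 1" using clinear_on_zero[OF f(1) assms(3)] s(1) by simp
  ultimately show ?thesis by (auto simp: bdd_above_def)
qed

lemma dual_seminorm_0 [simp]: "dual_seminorm B 0 = 0"
  by (cases "B = {}") (auto simp: dual_seminorm_def zero_fun_def image_constant_conv)

lemma dual_seminorm_add:
  assumes "tvs_bounded T B" "csubspace_set (topspace T)"
    "f \<in> continuous_dual T" "g \<in> continuous_dual T"
  shows "dual_seminorm B (f + g) \<le> dual_seminorm B f + dual_seminorm B g"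
  unfolding dual_seminorm_def
proof (rule cSUP_least)
  fix x assume x: "x \<in> insert 0 B"
  have "cmod ((f + g) x) \<le> cmod (f x) + cmod (g x)" by (simp add: norm_triangle_ineq)
  also have "\<dots> \<le> (SUP x\<in>insert 0 B. cmod (f x)) + (SUP x\<in>insert 0 B. cmod (g x))"
    by (intro add_mono cSUP_upper bdd_above_dual[OF assms(1)] assms x)
  finally show "cmod ((f + g) x) \<le> \<dots>" .
qed simp

lemma dual_seminorm_triangle:
  assumes "tvs_bounded T B" "csubspace_set (topspace T)"
    "f \<in> continuous_dual T" "g \<in> continuous_dual T" "h \<in> continuous_dual T"
  shows "dual_seminorm B (f - h) \<le> dual_seminorm B (f - g) + dual_seminorm B (g - h)"
  using dual_seminorm_add[OF assms(1,2), of "f - g" "g - h"]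
    csubspace_setD(4)[OF csubspace_set_continuous_dual assms(3,4)]
    csubspace_setD(4)[OF csubspace_set_continuous_dual assms(4,5)]
  by (simp add: fun_eq_iff algebra_simps)

text \<open>The adjoint of a continuous linear map.\<close>

definition adjoint_on :: "'x set \<Rightarrow> ('x \<Rightarrow> 'y) \<Rightarrow> ('y \<Rightarrow> complex) \<Rightarrow> 'x \<Rightarrow> complex" where
  "adjoint_on S g f = (\<lambda>x. if x \<in> S then f (g x) else 0)"

lemma adjoint_on:
  assumes g: "continuous_map T T' g" "clinear_on (topspace T) g"
    and T: "csubspace_set (topspace T)" "csubspace_set (topspace T')"
  shows "clinear_on (continuous_dual T') (adjoint_on (topspace T) g)"
    and "continuous_map (strong_topology T') (strong_topology T) (adjoint_on (topspace T) g)"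
proof -
  have gT: "g x \<in> topspace T'" if "x \<in> topspace T" for x
    using g(1) that by (auto simp: continuous_map_def)
  show "clinear_on (continuous_dual T') (adjoint_on (topspace T) g)"
    by (auto simp: clinear_on_def adjoint_on_def scaleC_fun_def)
  show "continuous_map (strong_topology T') (strong_topology T) (adjoint_on (topspace T) g)"
    unfolding strong_topology_def
  proof (rule continuous_map_seminorm_topology)
    fix f assume f: "f \<in> continuous_dual T'"
    have "continuous_map T euclidean (adjoint_on (topspace T) g f)"
    proof (rule continuous_map_eq[of _ _ "f \<circ> g"])
      show "continuous_map T euclidean (f \<circ> g)"
        using f by (intro continuous_map_compose[OF g(1)]) (auto simp: continuous_dual_def)
    qed (auto simp: adjoint_on_def)
    moreover have "clinear_on (topspace T) (adjoint_on (topspace T) g f)"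
      using f g(2) gT csubspace_setD[OF T(1)]
      unfolding clinear_on_def adjoint_on_def continuous_dual_def by auto
    ultimately show "adjoint_on (topspace T) g f \<in> continuous_dual T"
      by (auto simp: continuous_dual_def adjoint_on_def)
  next
    fix q x y z assume "q \<in> {dual_seminorm B |B. tvs_bounded T B}"
      "x \<in> continuous_dual T" "y \<in> continuous_dual T" "z \<in> continuous_dual T"
    then show "q (x - z) \<le> q (x - y) + q (y - z)"
      using dual_seminorm_triangle[OF _ T(1)] by blast
  next
    fix q assume "q \<in> {dual_seminorm B |B. tvs_bounded T B}"
    then obtain B where B: "tvs_bounded T B" "q = dual_seminorm B" by auto
    have "B \<subseteq> topspace T" using B(1) by (auto simp: tvs_bounded_def)
    moreover have "g 0 = 0" by (rule clinear_on_zero[OF g(2) T(1)])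
    ultimately have "q (adjoint_on (topspace T) g f - adjoint_on (topspace T) g h)
        = dual_seminorm (g ` B) (f - h)" for f h
      unfolding B(2) dual_seminorm_def using csubspace_setD(1)[OF T(1)]
      by (intro arg_cong[where f = Sup]) (force simp: adjoint_on_def image_image)
    moreover have "tvs_bounded T' (g ` B)" by (rule tvs_bounded_image[OF B(1) g T(1)])
    ultimately show "\<exists>q'\<in>{dual_seminorm B |B. tvs_bounded T' B}. \<exists>C>0.
        \<forall>x\<in>continuous_dual T'. \<forall>y\<in>continuous_dual T'.
          q (adjoint_on (topspace T) g x - adjoint_on (topspace T) g y) \<le> C * q' (x - y)"
      by (intro bexI[of _ "dual_seminorm (g ` B)"] exI[of _ 1]) auto
  qed auto
qed

lemma wf_dual_bimodule:
  assumes M: "wf_bimodule M"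
  shows "wf_bimodule (dual_bimodule M)"
proof -
  have S: "csubspace_set (lcb_space M)" using M by (simp add: wf_bimodule_def)
  have eq: "lact (dual_bimodule M) b = adjoint_on (lcb_space M) (\<lambda>x. ract M x b)"
    "(\<lambda>f. ract (dual_bimodule M) f b) = adjoint_on (lcb_space M) (lact M b)"
    "lcb_topology (dual_bimodule M) = strong_topology (lcb_topology M)" for b
    by (auto simp: dual_bimodule_def adjoint_on_def fun_eq_iff)
  show ?thesis
    unfolding wf_bimodule_def[of "dual_bimodule M"] eq topspace_strong_topology
    using M S by (auto simp: wf_bimodule_def intro!: csubspace_set_continuous_dual adjoint_on)
qed

lemma lcb_iso_inverse:
  assumes "lcb_iso \<phi> M N" "wf_bimodule M"
  obtains \<psi> where "lcb_iso \<psi> N M" "homeomorphic_maps (lcb_topology M) (lcb_topology N) \<phi> \<psi>"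
    "wf_bimodule N"
proof -
  obtain \<psi> where h: "homeomorphic_maps (lcb_topology M) (lcb_topology N) \<phi> \<psi>"
    using assms(1) unfolding lcb_iso_def homeomorphic_map_maps by blast
  then have c: "continuous_map (lcb_topology M) (lcb_topology N) \<phi>"
      "continuous_map (lcb_topology N) (lcb_topology M) \<psi>"
    and inv: "\<And>x. x \<in> lcb_space M \<Longrightarrow> \<psi> (\<phi> x) = x" "\<And>y. y \<in> lcb_space N \<Longrightarrow> \<phi> (\<psi> y) = y"
    by (auto simp: homeomorphic_maps_def)
  have m: "\<And>x. x \<in> lcb_space M \<Longrightarrow> \<phi> x \<in> lcb_space N" "\<And>y. y \<in> lcb_space N \<Longrightarrow> \<psi> y \<in> lcb_space M"
    using c by (auto simp: continuous_map_def)
  have lin: "clinear_on (lcb_space M) \<phi>"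
    and act: "\<And>b x. x \<in> lcb_space M \<Longrightarrow> lact N b (\<phi> x) = \<phi> (lact M b x)"
      "\<And>b x. x \<in> lcb_space M \<Longrightarrow> ract N (\<phi> x) b = \<phi> (ract M x b)"
    using assms(1) by (auto simp: lcb_iso_def)
  have S: "csubspace_set (lcb_space M)"
    and actM: "\<And>b. clinear_on (lcb_space M) (lact M b)"
      "\<And>b. clinear_on (lcb_space M) (\<lambda>x. ract M x b)"
      "\<And>b. continuous_map (lcb_topology M) (lcb_topology M) (lact M b)"
      "\<And>b. continuous_map (lcb_topology M) (lcb_topology M) (\<lambda>x. ract M x b)"
    using assms(2) by (auto simp: wf_bimodule_def)
  have mM: "\<And>b x. x \<in> lcb_space M \<Longrightarrow> lact M b x \<in> lcb_space M"
      "\<And>b x. x \<in> lcb_space M \<Longrightarrow> ract M x b \<in> lcb_space M"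
    using actM(3,4) by (auto simp: continuous_map_def Pi_iff)
  have add: "x + y = \<phi> (\<psi> x + \<psi> y)" if "x \<in> lcb_space N" "y \<in> lcb_space N" for x y
    using that by (simp add: clinear_onD[OF lin] m inv)
  have sc: "c *\<^sub>C x = \<phi> (c *\<^sub>C \<psi> x)" if "x \<in> lcb_space N" for x c
    using that by (simp add: clinear_onD[OF lin] m inv)
  have SN: "csubspace_set (lcb_space N)"
    unfolding csubspace_set_def
  proof (intro conjI ballI allI)
    show "0 \<in> lcb_space N" using m(1)[OF csubspace_setD(1)[OF S]] clinear_on_zero[OF lin S] by simp
    show "x + y \<in> lcb_space N" if "x \<in> lcb_space N" "y \<in> lcb_space N" for x y
      unfolding add[OF that] using that by (intro m csubspace_setD(2)[OF S])
    show "c *\<^sub>C x \<in> lcb_space N" if "x \<in> lcb_space N" for x c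
      unfolding sc[OF that] using that by (intro m csubspace_setD(3)[OF S])
  qed
  have linN: "clinear_on (lcb_space N) \<psi>"
    unfolding clinear_on_def
    by (auto simp: add sc inv m csubspace_setD[OF S])
  have actN: "lact N b y = \<phi> (lact M b (\<psi> y))" "ract N y b = \<phi> (ract M (\<psi> y) b)"
    if "y \<in> lcb_space N" for b y
    using act[of "\<psi> y"] inv(2)[OF that] m(2)[OF that] by auto
  have isoN: "lcb_iso \<psi> N M"
    using h linN by (auto simp: lcb_iso_def homeomorphic_maps_map actN inv m mM)
  have conj: "continuous_map (lcb_topology N) (lcb_topology N) (\<phi> \<circ> g \<circ> \<psi>)"
    if "continuous_map (lcb_topology M) (lcb_topology M) g" for g
    using c that by (meson continuous_map_compose)
  have cN: "continuous_map (lcb_topology N) (lcb_topology N) (lact N b)"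
    "continuous_map (lcb_topology N) (lcb_topology N) (\<lambda>y. ract N y b)" for b
  proof -
    show "continuous_map (lcb_topology N) (lcb_topology N) (lact N b)"
      by (rule continuous_map_eq[OF conj[OF actM(3)[of b]]]) (simp add: actN)
    show "continuous_map (lcb_topology N) (lcb_topology N) (\<lambda>y. ract N y b)"
      by (rule continuous_map_eq[OF conj[OF actM(4)[of b]]]) (simp add: actN)
  qed
  have "clinear_on (lcb_space N) (lact N b)" "clinear_on (lcb_space N) (\<lambda>y. ract N y b)" for b
    unfolding clinear_on_def
    by (auto simp: actN csubspace_setD[OF SN] clinear_onD[OF linN] clinear_onD[OF actM(1)]
        clinear_onD[OF actM(2)] clinear_onD[OF lin] m mM)
  then have "wf_bimodule N" using SN cN by (auto simp: wf_bimodule_def)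
  with isoN h show ?thesis using that by blast
qed

lemma lcb_iso_dual:
  assumes "lcb_iso \<phi> M N" "wf_bimodule M"
  shows "lcb_isomorphic (dual_bimodule M) (dual_bimodule N)"
proof -
  obtain \<psi> where psi: "lcb_iso \<psi> N M"
    and h: "homeomorphic_maps (lcb_topology M) (lcb_topology N) \<phi> \<psi>"
    and wf: "wf_bimodule N"
    using lcb_iso_inverse[OF assms] .
  have c: "continuous_map (lcb_topology M) (lcb_topology N) \<phi>"
      "continuous_map (lcb_topology N) (lcb_topology M) \<psi>"
    and inv: "\<And>x. x \<in> lcb_space M \<Longrightarrow> \<psi> (\<phi> x) = x" "\<And>y. y \<in> lcb_space N \<Longrightarrow> \<phi> (\<psi> y) = y"
    using h by (auto simp: homeomorphic_maps_def)
  have m: "\<And>x. x \<in> lcb_space M \<Longrightarrow> \<phi> x \<in> lcb_space N" "\<And>y. y \<in> lcb_space N \<Longrightarrow> \<psi> y \<in> lcb_space M"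
    using c by (auto simp: continuous_map_def)
  have lin: "clinear_on (lcb_space M) \<phi>" "clinear_on (lcb_space N) \<psi>"
    using assms(1) psi by (auto simp: lcb_iso_def)
  have S: "csubspace_set (lcb_space M)" "csubspace_set (lcb_space N)"
    using assms(2) wf by (auto simp: wf_bimodule_def)
  have mN: "\<And>b x. x \<in> lcb_space N \<Longrightarrow> lact N b x \<in> lcb_space N"
      "\<And>b x. x \<in> lcb_space N \<Longrightarrow> ract N x b \<in> lcb_space N"
    using wf by (auto simp: wf_bimodule_def continuous_map_def Pi_iff)
  let ?f = "adjoint_on (lcb_space N) \<psi>" and ?g = "adjoint_on (lcb_space M) \<phi>"
  have hd: "homeomorphic_maps (strong_topology (lcb_topology M)) (strong_topology (lcb_topology N)) ?f ?g"
    unfolding homeomorphic_maps_def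
    using adjoint_on(2)[OF c(2) lin(2) S(2,1)] adjoint_on(2)[OF c(1) lin(1) S]
    by (auto simp: adjoint_on_def inv m fun_eq_iff continuous_dual_def)
  have ld: "clinear_on (continuous_dual (lcb_topology M)) ?f"
    by (rule adjoint_on(1)[OF c(2) lin(2) S(2,1)])
  have ad: "?f (lact (dual_bimodule M) b x) = lact (dual_bimodule N) b (?f x)"
    "?f (ract (dual_bimodule M) x b) = ract (dual_bimodule N) (?f x) b" for b x
    using psi by (auto simp: dual_bimodule_def adjoint_on_def fun_eq_iff m mN lcb_iso_def)
  have td: "lcb_topology (dual_bimodule K) = strong_topology (lcb_topology K)"
    for K :: "('k, 'z::complex_vector) lc_bimodule"
    by (simp add: dual_bimodule_def)
  have "lcb_iso ?f (dual_bimodule M) (dual_bimodule N)"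
    unfolding lcb_iso_def td topspace_strong_topology
    using homeomorphic_maps_imp_map[OF hd] ld ad by blast
  then show ?thesis by (auto simp: lcb_isomorphic_def)
qed

lemma lcb_isomorphic_sym:
  assumes "lcb_isomorphic M N" "wf_bimodule M"
  shows "lcb_isomorphic N M"
proof -
  obtain \<phi> where phi: "lcb_iso \<phi> M N" using assms(1) unfolding lcb_isomorphic_def by (elim exE)
  show ?thesis
    unfolding lcb_isomorphic_def
    by (rule lcb_iso_inverse[OF phi assms(2)]) (rule exI)
qed

lemma lcb_isomorphic_wf:
  assumes "lcb_isomorphic M N" "wf_bimodule M"
  shows "wf_bimodule N"
proof -
  obtain \<phi> where phi: "lcb_iso \<phi> M N" using assms(1) unfolding lcb_isomorphic_def by (elim exE)
  show ?thesis by (rule lcb_iso_inverse[OF phi assms(2)])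
qed

lemma lcb_isomorphic_refl: "lcb_isomorphic M M"
proof -
  have "lcb_iso id M M" by (auto simp: lcb_iso_def clinear_on_def)
  then show ?thesis by (auto simp: lcb_isomorphic_def)
qed

lemma lcb_isomorphic_trans:
  assumes "lcb_isomorphic M N" "lcb_isomorphic N K"
  shows "lcb_isomorphic M K"
proof -
  obtain f g where f: "lcb_iso f M N" and g: "lcb_iso g N K"
    using assms by (auto simp: lcb_isomorphic_def)
  have "f x \<in> lcb_space N" if "x \<in> lcb_space M" for x
    using f that homeomorphic_imp_surjective_map by (fastforce simp: lcb_iso_def)
  moreover have "homeomorphic_map (lcb_topology M) (lcb_topology K) (g \<circ> f)"
    using f g by (auto simp: lcb_iso_def intro: homeomorphic_map_compose)
  ultimately have "lcb_iso (g \<circ> f) M K"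
    using f g by (auto simp: lcb_iso_def clinear_on_def)
  then show ?thesis by (auto simp: lcb_isomorphic_def)
qed

lemma iterated_dual_wf:
  fixes M :: "('a::complex_algebra, 'b::complex_vector) lc_bimodule"
  assumes "frechet_algebra p"
  shows "iterated_dual p n M \<Longrightarrow> wf_bimodule M"
proof (induction n arbitrary: M)
  case 0
  then have "lcb_isomorphic (regular_bimodule p) M" by simp
  then show ?case by (rule lcb_isomorphic_wf) (rule wf_regular_bimodule[OF assms])
next
  case (Suc n)
  then obtain M' :: "('a, 'b) lc_bimodule"
    where M': "iterated_dual p n M'" "lcb_isomorphic (dual_bimodule M') M" by auto
  show ?case by (rule lcb_isomorphic_wf[OF M'(2) wf_dual_bimodule[OF Suc.IH[OF M'(1)]]])
qed

theorem iterated_dual_unique: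
  fixes M :: "('b::complex_algebra, 'u::complex_vector) lc_bimodule"
    and N :: "('b, 'v::complex_vector) lc_bimodule"
  assumes "frechet_algebra p" "iterated_dual p n M" "iterated_dual p n N"
  shows "lcb_isomorphic M N"
  using assms(2,3)
proof (induction n arbitrary: M N)
  case 0
  then have "lcb_isomorphic M (regular_bimodule p)" "lcb_isomorphic (regular_bimodule p) N"
    using lcb_isomorphic_sym[OF _ wf_regular_bimodule[OF assms(1)]] by simp_all
  then show ?case by (rule lcb_isomorphic_trans)
next
  case (Suc n)
  obtain M' :: "('b, 'u) lc_bimodule"
    where M': "iterated_dual p n M'" "lcb_isomorphic (dual_bimodule M') M"
    using Suc.prems(1) by auto
  obtain N' :: "('b, 'v) lc_bimodule"
    where N': "iterated_dual p n N'" "lcb_isomorphic (dual_bimodule N') N"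
    using Suc.prems(2) by auto
  have wf: "wf_bimodule M'" using iterated_dual_wf[OF assms(1) M'(1)] .
  have "lcb_isomorphic (dual_bimodule M') (dual_bimodule N')"
    using Suc.IH[OF M'(1) N'(1)] lcb_iso_dual[OF _ wf] by (auto simp: lcb_isomorphic_def)
  moreover have "lcb_isomorphic M (dual_bimodule M')"
    using lcb_isomorphic_sym[OF M'(2) wf_dual_bimodule[OF wf]] .
  ultimately show ?case using lcb_isomorphic_trans[OF lcb_isomorphic_trans N'(2)] by blast
qed

lemma derivations_inner_transfer:
  assumes "lcb_isomorphic M N" "wf_bimodule M"
    and inner: "\<And>D. continuous_derivation p M D \<Longrightarrow> inner_derivation M D"
    and D: "continuous_derivation p N D"
  shows "inner_derivation N D"
proof -
  obtain \<phi> where phi: "lcb_iso \<phi> M N" using assms(1) by (auto simp: lcb_isomorphic_def)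
  obtain \<psi> where psi: "lcb_iso \<psi> N M"
    and h: "homeomorphic_maps (lcb_topology M) (lcb_topology N) \<phi> \<psi>" and wf: "wf_bimodule N"
    using lcb_iso_inverse[OF phi assms(2)] .
  have c: "continuous_map (lcb_topology M) (lcb_topology N) \<phi>"
      "continuous_map (lcb_topology N) (lcb_topology M) \<psi>"
    and inv: "\<And>y. y \<in> lcb_space N \<Longrightarrow> \<phi> (\<psi> y) = y"
    using h by (auto simp: homeomorphic_maps_def)
  have m: "\<And>x. x \<in> lcb_space M \<Longrightarrow> \<phi> x \<in> lcb_space N"
    using c by (auto simp: continuous_map_def)
  have lin: "clinear_on (lcb_space M) \<phi>" "clinear_on (lcb_space N) \<psi>"
    using phi psi by (auto simp: lcb_iso_def)
  have S: "csubspace_set (lcb_space M)" using assms(2) by (auto simp: wf_bimodule_def)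
  have mM: "\<And>b x. x \<in> lcb_space M \<Longrightarrow> lact M b x \<in> lcb_space M"
      "\<And>b x. x \<in> lcb_space M \<Longrightarrow> ract M x b \<in> lcb_space M"
    and mN: "\<And>b x. x \<in> lcb_space N \<Longrightarrow> lact N b x \<in> lcb_space N"
      "\<And>b x. x \<in> lcb_space N \<Longrightarrow> ract N x b \<in> lcb_space N"
    using assms(2) wf by (auto simp: wf_bimodule_def continuous_map_def Pi_iff)
  have Dc: "continuous_map (frechet_topology p) (lcb_topology N) D"
    and Dl: "clinear_on UNIV D"
    and Dm: "\<And>a b. D (a * b) = lact N a (D b) + ract N (D a) b"
    using D by (auto simp: continuous_derivation_def)
  have DN: "D a \<in> lcb_space N" for a using Dc by (auto simp: continuous_map_def)
  have "continuous_map (frechet_topology p) (lcb_topology M) (\<psi> \<circ> D)"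
    using Dc c(2) by (rule continuous_map_compose)
  moreover have "clinear_on UNIV (\<psi> \<circ> D)"
    using Dl lin(2) DN by (auto simp: clinear_on_def)
  moreover have "(\<psi> \<circ> D) (a * b) = lact M a ((\<psi> \<circ> D) b) + ract M ((\<psi> \<circ> D) a) b" for a b
    using psi DN by (auto simp: Dm clinear_onD[OF lin(2)] mN lcb_iso_def)
  ultimately have "continuous_derivation p M (\<psi> \<circ> D)" by (auto simp: continuous_derivation_def)
  from inner[OF this]
  obtain x where x: "x \<in> lcb_space M" "\<And>b. \<psi> (D b) = lact M b x - ract M x b"
    by (auto simp: inner_derivation_def)
  have "D b = lact N b (\<phi> x) - ract N (\<phi> x) b" for b
  proof -
    have "D b = \<phi> (lact M b x - ract M x b)" using inv[OF DN] x(2) by metis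
    then show ?thesis using phi x(1) by (simp add: clinear_on_diff[OF lin(1) S] mM lcb_iso_def)
  qed
  then show ?thesis using m[OF x(1)] by (auto simp: inner_derivation_def)
qed

text \<open>One copy is enough to decide n-weak amenability, and the ambient space does not matter.\<close>

theorem n_weakly_amenable_iff:
  fixes M :: "('b::complex_algebra, 'u::complex_vector) lc_bimodule"
  assumes "frechet_algebra p" "iterated_dual p n M"
  shows "n_weakly_amenable TYPE('u) n p \<longleftrightarrow>
    (\<forall>D. continuous_derivation p M D \<longrightarrow> inner_derivation M D)"
  using assms iterated_dual_unique[OF assms(1), of n M] derivations_inner_transfer[of M]
    iterated_dual_wf[OF assms]
  unfolding n_weakly_amenable_def by blast

theorem n_weakly_amenable_ambient_cong:
  fixes p :: "nat \<Rightarrow> 'b::complex_algebra \<Rightarrow> real"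
  assumes "frechet_algebra p"
    "has_iterated_dual TYPE('u::complex_vector) n p" "has_iterated_dual TYPE('v::complex_vector) n p"
  shows "n_weakly_amenable TYPE('u) n p \<longleftrightarrow> n_weakly_amenable TYPE('v) n p"
proof -
  obtain M :: "('b, 'u) lc_bimodule" where M: "iterated_dual p n M"
    using assms(2) by (auto simp: has_iterated_dual_def)
  obtain N :: "('b, 'v) lc_bimodule" where N: "iterated_dual p n N"
    using assms(3) by (auto simp: has_iterated_dual_def)
  note MN = iterated_dual_unique[OF assms(1) M N] and NM = iterated_dual_unique[OF assms(1) N M]
  note wf = iterated_dual_wf[OF assms(1) M] iterated_dual_wf[OF assms(1) N]
  show ?thesis
    unfolding n_weakly_amenable_iff[OF assms(1) M] n_weakly_amenable_iff[OF assms(1) N]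
    using derivations_inner_transfer[OF MN wf(1)] derivations_inner_transfer[OF NM wf(2)] by blast
qed

lemma lcb_isomorphic_copy:
  fixes M :: "('b, 'x::complex_vector) lc_bimodule" and j :: "'x \<Rightarrow> 'u::complex_vector"
  assumes "inj j" "clinear_on UNIV j"
  shows "\<exists>N :: ('b, 'u) lc_bimodule. lcb_isomorphic M N"
proof -
  define N :: "('b, 'u) lc_bimodule" where
    "N = \<lparr>lcb_topology = pullback_topology (range j) (inv j) (lcb_topology M),
      lact = (\<lambda>b y. j (lact M b (inv j y))), ract = (\<lambda>y b. j (ract M (inv j y) b))\<rparr>"
  have "homeomorphic_maps (lcb_topology M) (lcb_topology N) j (inv j)"
    unfolding homeomorphic_maps_def
  proof (intro conjI)
    show "continuous_map (lcb_topology M) (lcb_topology N) j"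
      unfolding N_def lc_bimodule.simps
      by (rule continuous_map_pullback') (use assms(1) in \<open>auto simp: o_def\<close>)
    show "continuous_map (lcb_topology N) (lcb_topology M) (inv j)"
      unfolding N_def lc_bimodule.simps
      using continuous_map_pullback[of "lcb_topology M" "lcb_topology M" id] by (simp add: o_def)
  qed (use assms(1) in \<open>auto simp: N_def topspace_pullback_topology\<close>)
  then have "lcb_iso j M N"
    using assms(2) by (auto simp: lcb_iso_def homeomorphic_maps_map clinear_on_def N_def assms(1))
  then show ?thesis by (auto simp: lcb_isomorphic_def)
qed

lemma iterated_dual_copy:
  fixes M :: "('b::complex_algebra, 'u::complex_vector) lc_bimodule"
    and M' :: "('b, 'v::complex_vector) lc_bimodule" and j :: "'u \<Rightarrow> 'v"
  assumes "frechet_algebra p" "inj j" "clinear_on UNIV j"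
  shows "iterated_dual p n M \<Longrightarrow> lcb_isomorphic M M' \<Longrightarrow> iterated_dual p n M'"
proof (induction n arbitrary: M M')
  case 0
  then show ?case using lcb_isomorphic_trans by auto
next
  case (Suc n)
  obtain L :: "('b, 'u) lc_bimodule"
    where L: "iterated_dual p n L" "lcb_isomorphic (dual_bimodule L) M"
    using Suc.prems(1) by auto
  obtain K :: "('b, 'v) lc_bimodule" where K: "lcb_isomorphic L K"
    using lcb_isomorphic_copy[OF assms(2,3)] by blast
  have wf: "wf_bimodule L" using iterated_dual_wf[OF assms(1) L(1)] .
  have "lcb_isomorphic (dual_bimodule L) (dual_bimodule K)"
    using K lcb_iso_dual[OF _ wf] by (auto simp: lcb_isomorphic_def)
  then have "lcb_isomorphic (dual_bimodule K) (dual_bimodule L)"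
    using lcb_isomorphic_sym wf_dual_bimodule[OF wf] by blast
  then have "lcb_isomorphic (dual_bimodule K) M'"
    by (rule lcb_isomorphic_trans[OF _ lcb_isomorphic_trans[OF L(2) Suc.prems(2)]])
  then show ?case using Suc.IH[OF L(1) K] by auto
qed

theorem has_iterated_dual_0:
  fixes p :: "nat \<Rightarrow> 'b::complex_algebra \<Rightarrow> real"
  shows "has_iterated_dual TYPE('b) 0 p"
  using lcb_isomorphic_refl[of "regular_bimodule p"]
  unfolding has_iterated_dual_def iterated_dual.simps by blast

theorem has_iterated_dual_mono:
  fixes p :: "nat \<Rightarrow> 'b::complex_algebra \<Rightarrow> real"
    and j :: "'u::complex_vector \<Rightarrow> 'v::complex_vector"
  assumes "frechet_algebra p" "inj j" "clinear_on UNIV j" "has_iterated_dual TYPE('u) n p"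
  shows "has_iterated_dual TYPE('v) n p"
  using assms(4) lcb_isomorphic_copy[OF assms(2,3)] iterated_dual_copy[OF assms(1-3)]
  unfolding has_iterated_dual_def by blast

theorem has_iterated_dual_Suc:
  fixes p :: "nat \<Rightarrow> 'b::complex_algebra \<Rightarrow> real"
  assumes "frechet_algebra p" "has_iterated_dual TYPE('u::complex_vector) n p"
  shows "has_iterated_dual TYPE('u \<times> ('u \<Rightarrow> complex)) (Suc n) p"
proof -
  obtain M :: "('b, 'u) lc_bimodule" where M: "iterated_dual p n M"
    using assms(2) by (auto simp: has_iterated_dual_def)
  have j: "inj (\<lambda>x::'u. (x, 0 :: 'u \<Rightarrow> complex))" "clinear_on UNIV (\<lambda>x::'u. (x, 0 :: 'u \<Rightarrow> complex))"
    "inj (\<lambda>f::'u \<Rightarrow> complex. (0 :: 'u, f))" "clinear_on UNIV (\<lambda>f::'u \<Rightarrow> complex. (0 :: 'u, f))"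
    by (auto simp: inj_def clinear_on_def scaleC_prod_def)
  obtain N :: "('b, 'u \<times> ('u \<Rightarrow> complex)) lc_bimodule" where N: "lcb_isomorphic M N"
    using lcb_isomorphic_copy[OF j(1,2)] by blast
  have wf: "wf_bimodule M" using iterated_dual_wf[OF assms(1) M] .
  obtain K :: "('b, 'u \<times> ('u \<Rightarrow> complex)) lc_bimodule" where K: "lcb_isomorphic (dual_bimodule M) K"
    using lcb_isomorphic_copy[OF j(3,4)] by blast
  have "lcb_isomorphic (dual_bimodule M) (dual_bimodule N)"
    using N lcb_iso_dual[OF _ wf] by (auto simp: lcb_isomorphic_def)
  then have "lcb_isomorphic (dual_bimodule N) K"
    by (rule lcb_isomorphic_trans[OF lcb_isomorphic_sym[OF _ wf_dual_bimodule[OF wf]] K])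
  then have "iterated_dual p (Suc n) K"
    using iterated_dual_copy[OF assms(1) j(1,2) M N] by auto
  then show ?thesis by (auto simp: has_iterated_dual_def)
qed

end

theory Submission
  imports Defs
begin

text \<open>
  For every n the n-th dual of the unitization is the direct sum of the n-th dual M of A and the
  complex numbers, with the action
  \<open>(a, \<mu>) (x, l) = (a x + \<mu> x + l \<iota>(a), \<tau>(a)(x) + \<mu> l)\<close>, and likewise on the right. For even n, \<open>\<iota>\<close> is
  the canonical embedding of A into M and \<open>\<tau> = 0\<close>; for odd n, \<open>\<iota> = 0\<close> and \<open>\<tau>\<close> is the canonical
  pairing. Passing to the dual replaces \<open>(\<iota>, \<tau>)\<close> by \<open>(\<tau>, evaluation at \<iota>)\<close>.

  A derivation of the unitization vanishes at the identity, so it is a pair \<open>(E, d)\<close> of maps on A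
  with \<open>d(a b) = \<tau>(a)(E b) + \<tau>(b)(E a)\<close> and \<open>E(a b) = a E(b) + E(a) b + d(b) \<iota>(a) + d(a) \<iota>(b)\<close>. If E is
  the inner derivation given by x, then d vanishes on products, hence \<open>d = 0\<close> by the hypothesis on
  A, and the pair is inner; the same argument gives \<open>d = 0\<close> when \<open>\<tau> = 0\<close>. Conversely a derivation
  E of A is extended to the unitization by a functional d that satisfies the first identity.
  Continuity of functionals on A is read off from bounded sets, since Frechet spaces are
  bornological.
\<close>

section \<open>Neighbourhoods and bounded sets in seminorm topologies\<close>

text \<open>Subbasic balls may have any centre; the triangle inequality recentres them at
  \<open>x\<close>. Intersections are absorbed by taking the union of the seminorm sets and the
  smaller radius.\<close>

lemma seminorm_topology_nhd_base:
  assumes tri: "\<And>q x y z. q \<in> P \<Longrightarrow> x \<in> S \<Longrightarrow> y \<in> S \<Longrightarrow> z \<in> S \<Longrightarrow> q (x - z) \<le> q (x - y) + q (y - z)"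
    and V: "openin (seminorm_topology S P) V" "x \<in> V"
  obtains F r where "finite F" "F \<subseteq> P" "r > 0" "{y \<in> S. \<forall>q\<in>F. q (y - x) < r} \<subseteq> V"
proof -
  have "x \<in> S" using openin_subset[OF V(1)] V(2) by auto
  have "\<exists>F r. finite F \<and> F \<subseteq> P \<and> r > 0 \<and> {y \<in> S. \<forall>q\<in>F. q (y - x) < r} \<subseteq> V"
    if "generate_topology_on (insert S {{y \<in> S. q (y - x) < r} | q x r. q \<in> P \<and> x \<in> S \<and> 0 < r}) V"
      "x \<in> V" for V
    using that
  proof (induction rule: generate_topology_on.induct)
    case (Int a b)
    then obtain F r G s where F: "finite F" "F \<subseteq> P" "r > 0" "{y \<in> S. \<forall>q\<in>F. q (y - x) < r} \<subseteq> a"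
      and G: "finite G" "G \<subseteq> P" "s > 0" "{y \<in> S. \<forall>q\<in>G. q (y - x) < s} \<subseteq> b"
      by blast
    have "{y \<in> S. \<forall>q\<in>F \<union> G. q (y - x) < min r s} \<subseteq> a \<inter> b" using F(4) G(4) by fastforce
    then show ?case using F G by (intro exI[of _ "F \<union> G"] exI[of _ "min r s"]) auto
  next
    case (UN K)
    then obtain k where k: "k \<in> K" "x \<in> k" by auto
    from UN.IH[OF k] obtain F r
      where "finite F" "F \<subseteq> P" "r > 0" "{y \<in> S. \<forall>q\<in>F. q (y - x) < r} \<subseteq> k"
      by (elim exE conjE)
    with k(1) show ?case by (intro exI[of _ F] exI[of _ r]) auto
  next
    case (Basis b)
    show ?case
    proof (cases "b = S")
      case True
      then show ?thesis by (intro exI[of _ "{}"] exI[of _ 1]) auto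
    next
      case False
      then obtain q z r where b: "b = {y \<in> S. q (y - z) < r}" "q \<in> P" "z \<in> S" "r > 0"
        using Basis(1) by auto
      \<comment> \<open>The new radius is the distance left from \<open>x\<close> to the boundary of
        the ball around \<open>z\<close>.\<close>
      have "{y \<in> S. \<forall>q\<in>{q}. q (y - x) < r - q (x - z)} \<subseteq> b"
      proof
        fix y assume "y \<in> {y \<in> S. \<forall>q\<in>{q}. q (y - x) < r - q (x - z)}"
        then show "y \<in> b" using tri[OF b(2), of y x z] b(3) \<open>x \<in> S\<close> by (auto simp: b(1))
      qed
      then show ?thesis using b Basis(2) by (intro exI[of _ "{q}"] exI[of _ "r - q (x - z)"]) auto
    qed
  qed auto
  then show ?thesis
    using that V unfolding seminorm_topology_def openin_topology_generated_by_iff by blast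
qed

text \<open>A pointwise criterion with an arbitrary topology on the domain. It serves for maps out
  of products and for maps with no Lipschitz bound at hand, where
  \<open>continuous_map_seminorm_topology\<close> does not apply.\<close>

lemma continuous_map_into_seminorm_topology:
  assumes S: "\<And>x. x \<in> topspace X \<Longrightarrow> f x \<in> S"
    and tri: "\<And>q x y z. q \<in> P \<Longrightarrow> x \<in> S \<Longrightarrow> y \<in> S \<Longrightarrow> z \<in> S \<Longrightarrow> q (x - z) \<le> q (x - y) + q (y - z)"
    and nhd: "\<And>q x e. q \<in> P \<Longrightarrow> x \<in> topspace X \<Longrightarrow> e > 0 \<Longrightarrow>
      \<exists>V. openin X V \<and> x \<in> V \<and> (\<forall>y\<in>V. q (f y - f x) < e)"
  shows "continuous_map X (seminorm_topology S P) f"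
proof -
  have "openin X (f -` U \<inter> topspace X)"
    if U: "U \<in> insert S {{y \<in> S. q (y - x) < r} | q x r. q \<in> P \<and> x \<in> S \<and> 0 < r}" for U
  proof (cases "U = S")
    case True
    then have "f -` U \<inter> topspace X = topspace X" using S by auto
    then show ?thesis by simp
  next
    case False
    then obtain q z r where q: "q \<in> P" "z \<in> S" "0 < r" "U = {y \<in> S. q (y - z) < r}"
      using U by auto
    show ?thesis
    proof (subst openin_subopen, intro ballI)
      fix x assume x: "x \<in> f -` U \<inter> topspace X"
      then have "r - q (f x - z) > 0" using q by auto
      moreover have "x \<in> topspace X" using x by simp
      ultimately obtain V
        where V: "openin X V" "x \<in> V" "\<forall>y\<in>V. q (f y - f x) < r - q (f x - z)"
        using nhd[OF q(1), of x "r - q (f x - z)"] by blast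
      have "V \<subseteq> f -` U \<inter> topspace X"
      proof
        fix y assume y: "y \<in> V"
        then have yX: "y \<in> topspace X" using openin_subset[OF V(1)] by (rule subsetD[rotated])
        have "q (f y - z) \<le> q (f y - f x) + q (f x - z)"
          by (rule tri[OF q(1)]) (use S yX x q(2) in auto)
        then show "y \<in> f -` U \<inter> topspace X"
          using V(3)[rule_format, OF y] S[OF yX] yX by (simp add: q(4))
      qed
      then show "\<exists>T. openin X T \<and> x \<in> T \<and> T \<subseteq> f -` U \<inter> topspace X" using V by blast
    qed
  qed
  then show ?thesis
    unfolding seminorm_topology_def
    by (intro continuous_on_generated_topo) (use S in auto)
qed

text \<open>A neighbourhood of 0 contains a ball for finitely many seminorms; these have a common
  bound on \<open>B\<close>, and dividing by a large scalar moves \<open>B\<close> into the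
  ball.\<close>

lemma tvs_bounded_seminorm_topology:
  assumes S: "csubspace_set S"
    and tri: "\<And>q x y z. q \<in> P \<Longrightarrow> x \<in> S \<Longrightarrow> y \<in> S \<Longrightarrow> z \<in> S \<Longrightarrow> q (x - z) \<le> q (x - y) + q (y - z)"
    and hom: "\<And>q c x. q \<in> P \<Longrightarrow> x \<in> S \<Longrightarrow> q (c *\<^sub>C x) \<le> cmod c * q x"
    and B: "B \<subseteq> S" "\<And>q. q \<in> P \<Longrightarrow> \<exists>K. \<forall>x\<in>B. q x \<le> K"
  shows "tvs_bounded (seminorm_topology S P) B"
  unfolding tvs_bounded_def topspace_seminorm_topology
proof (intro conjI allI impI B(1))
  fix U assume "openin (seminorm_topology S P) U \<and> 0 \<in> U"
  then have U: "openin (seminorm_topology S P) U" "0 \<in> U" by auto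
  obtain F r where F: "finite F" "F \<subseteq> P" "r > 0" "{y \<in> S. \<forall>q\<in>F. q (y - 0) < r} \<subseteq> U"
    using U by (rule seminorm_topology_nhd_base[rotated]) (use tri in auto)
  have "\<exists>K. \<forall>q\<in>F. \<forall>x\<in>B. q x \<le> K"
    using F(1,2)
  proof (induction rule: finite_induct)
    case (insert q F)
    then obtain K where K: "\<forall>q\<in>F. \<forall>x\<in>B. q x \<le> K" by auto
    obtain L where "\<forall>x\<in>B. q x \<le> L" using B(2)[of q] insert by auto
    with K show ?case by (intro exI[of _ "max K L"]) fastforce
  qed auto
  then obtain K where K: "\<And>q x. q \<in> F \<Longrightarrow> x \<in> B \<Longrightarrow> q x \<le> K" by auto
  \<comment> \<open>The absolute value keeps \<open>s\<close> positive even if \<open>K\<close> is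
    negative; adding 1 makes the later inequality strict.\<close>
  define s where "s = (\<bar>K\<bar> + 1) / r"
  have s: "s > 0" using F(3) by (simp add: s_def)
  have "b \<in> scaleC (complex_of_real t) ` U" if t: "t > s" and b: "b \<in> B" for t b
  proof -
    have t0: "t > 0" using s t by simp
    let ?y = "complex_of_real (1 / t) *\<^sub>C b"
    have "q ?y < r" if q: "q \<in> F" for q
    proof -
      have "q ?y \<le> (1 / t) * q b"
        using hom[of q b "complex_of_real (1 / t)"] q F(2) b B(1) t0 by (auto simp: norm_divide)
      also have "\<dots> \<le> (1 / t) * (\<bar>K\<bar> + 1)"
        using K[OF q b] t0 by (intro mult_left_mono) auto
      also have "\<dots> < r" using t t0 F(3) by (simp add: s_def field_simps)
      finally show ?thesis .
    qed
    moreover have "?y \<in> S" using B(1) b csubspace_setD(3)[OF S] by auto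
    ultimately have "?y \<in> U" using F(4) by (simp add: subset_iff)
    moreover have "b = complex_of_real t *\<^sub>C ?y" using t0 by (simp flip: of_real_mult)
    ultimately show ?thesis by blast
  qed
  then show "\<exists>s>0. \<forall>t>s. B \<subseteq> scaleC (complex_of_real t) ` U" using s by blast
qed

lemma tvs_boundedE:
  assumes "tvs_bounded T B" "openin T U" "0 \<in> U"
  obtains s :: real where "s > 0" "B \<subseteq> scaleC (complex_of_real s) ` U"
proof -
  obtain s :: real where s: "s > 0" "\<forall>t>s. B \<subseteq> scaleC (complex_of_real t) ` U"
    using assms unfolding tvs_bounded_def by blast
  have "s + 1 > 0" using s(1) by simp
  moreover have "B \<subseteq> scaleC (complex_of_real (s + 1)) ` U" using s(2) by (simp del: of_real_add)
  ultimately show ?thesis by (rule that)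
qed

section \<open>Seminorms, bounded sets and evaluations on the strong dual\<close>

lemma dual_seminorm_upper:
  assumes "tvs_bounded T B" "f \<in> continuous_dual T" "csubspace_set (topspace T)" "x \<in> B"
  shows "cmod (f x) \<le> dual_seminorm B f"
  unfolding dual_seminorm_def by (rule cSUP_upper[OF _ bdd_above_dual[OF assms(1-3)]]) (use assms(4) in auto)

text \<open>The supremum also runs over the inserted point 0, whence the last two premises.\<close>

lemma dual_seminorm_least:
  assumes "\<And>x. x \<in> B \<Longrightarrow> cmod (f x) \<le> K" "f 0 = 0" "K \<ge> 0"
  shows "dual_seminorm B f \<le> K"
  unfolding dual_seminorm_def by (rule cSUP_least) (use assms in auto)

lemma continuous_dual_zero:
  assumes "f \<in> continuous_dual T" "csubspace_set (topspace T)"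
  shows "f 0 = 0"
  using assms clinear_on_zero by (auto simp: continuous_dual_def)

lemma dual_seminorm_nonneg:
  assumes "tvs_bounded T B" "f \<in> continuous_dual T" "csubspace_set (topspace T)"
  shows "0 \<le> dual_seminorm B f"
proof -
  have "cmod (f 0) \<le> dual_seminorm B f"
    unfolding dual_seminorm_def by (rule cSUP_upper[OF _ bdd_above_dual[OF assms]]) simp
  then show ?thesis by (meson norm_ge_zero order_trans)
qed

lemma dual_seminorm_scaleC:
  assumes "tvs_bounded T B" "f \<in> continuous_dual T" "csubspace_set (topspace T)"
  shows "dual_seminorm B (c *\<^sub>C f) \<le> cmod c * dual_seminorm B f"
proof (rule dual_seminorm_least)
  show "cmod ((c *\<^sub>C f) x) \<le> cmod c * dual_seminorm B f" if "x \<in> B" for x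
    using dual_seminorm_upper[OF assms that] by (simp add: scaleC_fun_def norm_mult mult_left_mono)
qed (use dual_seminorm_nonneg[OF assms] continuous_dual_zero[OF assms(2,3)] in \<open>auto simp: scaleC_fun_def\<close>)

text \<open>The defining seminorms of the strong topology are suprema over bounded sets, so uniform
  bounds on each bounded set bound every one of them.\<close>

lemma tvs_bounded_strong_topology:
  assumes "csubspace_set (topspace T)" "E \<subseteq> continuous_dual T"
    and "\<And>B. tvs_bounded T B \<Longrightarrow> \<exists>K\<ge>0. \<forall>f\<in>E. \<forall>x\<in>B. cmod (f x) \<le> K"
  shows "tvs_bounded (strong_topology T) E"
  unfolding strong_topology_def
proof (rule tvs_bounded_seminorm_topology[OF csubspace_set_continuous_dual])
  fix q assume "q \<in> {dual_seminorm B |B. tvs_bounded T B}"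
  then obtain B where B: "tvs_bounded T B" "q = dual_seminorm B" by auto
  obtain K where K: "K \<ge> 0" "\<And>f x. f \<in> E \<Longrightarrow> x \<in> B \<Longrightarrow> cmod (f x) \<le> K"
    using assms(3)[OF B(1)] by blast
  show "\<exists>K. \<forall>f\<in>E. q f \<le> K"
    unfolding B(2)
    by (intro exI[of _ K] ballI dual_seminorm_least K)
      (use continuous_dual_zero assms in auto)
next
  fix q f g h assume "q \<in> {dual_seminorm B |B. tvs_bounded T B}"
    "f \<in> continuous_dual T" "g \<in> continuous_dual T" "h \<in> continuous_dual T"
  then show "q (f - h) \<le> q (f - g) + q (g - h)" using dual_seminorm_triangle[OF _ assms(1)] by blast
next
  fix q c f assume "q \<in> {dual_seminorm B |B. tvs_bounded T B}" "f \<in> continuous_dual T"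
  then show "q (c *\<^sub>C f) \<le> cmod c * q f" using dual_seminorm_scaleC[OF _ _ assms(1)] by blast
qed (rule assms(2))

lemma openin_strong_ball:
  assumes "tvs_bounded T B" "f \<in> continuous_dual T" "r > 0"
  shows "openin (strong_topology T) {g \<in> continuous_dual T. dual_seminorm B (g - f) < r}"
  unfolding strong_topology_def by (rule openin_seminorm_ball) (use assms in auto)

text \<open>Evaluation at \<open>x\<close> is dominated by the seminorm of the singleton.
  Boundedness of the singleton is a premise because \<open>T\<close> is an arbitrary topology, in
  which neighbourhoods of 0 need not absorb points.\<close>

lemma continuous_map_evaluation:
  assumes "tvs_bounded T {x}" "csubspace_set (topspace T)"
  shows "continuous_map (strong_topology T) euclidean (\<lambda>f. f x :: complex)"
proof -
  have "openin (strong_topology T) {f \<in> continuous_dual T. f x \<in> U}" if U: "open U" for U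
  proof (subst openin_subopen, intro ballI)
    fix f assume f: "f \<in> {f \<in> continuous_dual T. f x \<in> U}"
    then obtain e where e: "e > 0" "ball (f x) e \<subseteq> U" using U openE by blast
    let ?V = "{g \<in> continuous_dual T. dual_seminorm {x} (g - f) < e}"
    have "?V \<subseteq> {f \<in> continuous_dual T. f x \<in> U}"
    proof
      fix g assume g: "g \<in> ?V"
      have "g - f \<in> continuous_dual T"
        using csubspace_setD(4)[OF csubspace_set_continuous_dual] f g by auto
      from dual_seminorm_upper[OF assms(1) this assms(2), of x]
      have "g x \<in> ball (f x) e" using g by (simp add: dist_norm norm_minus_commute)
      then show "g \<in> {f \<in> continuous_dual T. f x \<in> U}" using e(2) g by auto
    qed
    then show "\<exists>V. openin (strong_topology T) V \<and> f \<in> V \<and> V \<subseteq> {f \<in> continuous_dual T. f x \<in> U}"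
      using openin_strong_ball[OF assms(1) _ e(1), of f] f e(1) by (intro exI[of _ ?V]) auto
  qed
  then show ?thesis by (auto simp: continuous_map_def)
qed

section \<open>Neighbourhoods of 0, bounded sets and continuous functionals of a Frechet
  algebra\<close>

lemma frechet_nhd_base:
  assumes p: "frechet_algebra p" and V: "openin (frechet_topology p) V" "0 \<in> V"
  obtains l r where "r > 0" "{y. p l y < r} \<subseteq> V"
proof -
  obtain F r where F: "finite F" "F \<subseteq> range p" "r > 0" "{y \<in> UNIV. \<forall>q\<in>F. q (y - 0) < r} \<subseteq> V"
    using V unfolding frechet_topology_def
    by (rule seminorm_topology_nhd_base[rotated]) (use frechet_algebraD(7)[OF p] in auto)
  obtain I where I: "finite I" "F = p ` I" using F(1,2) by (meson finite_subset_image)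
  have mono: "p k x \<le> p l x" if "k \<le> l" for k l x
    using lift_Suc_mono_le[of "\<lambda>l. p l x", OF _ that] frechet_algebraD(4)[OF p] by blast
  \<comment> \<open>The seminorms increase, so the one with the largest index controls the others.
    If \<open>I\<close> is empty, \<open>Max I\<close> is unspecified, but then \<open>V\<close> is
    the whole space.\<close>
  have "{y. p (Max I) y < r} \<subseteq> V"
  proof
    fix y assume y: "y \<in> {y. p (Max I) y < r}"
    have "p k y < r" if "k \<in> I" for k using mono[of k "Max I" y] I(1) that y by auto
    then show "y \<in> V" using F(4) I(2) by auto
  qed
  then show ?thesis using that F(3) by blast
qed

lemma tvs_bounded_frechet:
  assumes p: "frechet_algebra p" and B: "\<And>l. \<exists>K. \<forall>x\<in>B. p l x \<le> K"
  shows "tvs_bounded (frechet_topology p) B"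
  unfolding frechet_topology_def
proof (rule tvs_bounded_seminorm_topology)
  fix q x y z assume "q \<in> range p"
  then show "q (x - z) \<le> q (x - y) + q (y - z)" using frechet_algebraD(7)[OF p] by auto
next
  fix q c x assume "q \<in> range p"
  then show "q (c *\<^sub>C x) \<le> cmod c * q x" using frechet_algebraD(2)[OF p] by auto
qed (use B in \<open>auto simp: csubspace_set_def\<close>)

text \<open>Rescale \<open>y\<close> to have \<open>p\<close>-value \<open>r / 2\<close>, strictly
  inside the ball; this is where the factor 2 comes from. If \<open>p y = 0\<close>, all multiples
  of \<open>y\<close> lie in the ball.\<close>

lemma seminorm_bound_from_nhd:
  fixes p q :: "'a::complex_vector \<Rightarrow> real"
  assumes p: "\<And>c x. p (c *\<^sub>C x) = cmod c * p x" "\<And>x. 0 \<le> p x"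
    and q: "\<And>c x. q (c *\<^sub>C x) = cmod c * q x"
    and r: "r > 0" "\<And>y. p y < r \<Longrightarrow> q y \<le> 1"
  shows "q y \<le> (2 / r) * p y"
proof (cases "p y = 0")
  case True
  have "c * q y \<le> 1" if "c > 0" for c
    using r(2)[of "complex_of_real c *\<^sub>C y"] that r(1) True by (simp add: p q)
  \<comment> \<open>A positive \<open>q y\<close> would give 2 \<le> 1.\<close>
  from this[of "2 / q y"] have "q y \<le> 0" by (cases "q y > 0") auto
  then show ?thesis using True by simp
next
  case False
  then have py: "p y > 0" using p(2)[of y] by simp
  have "p (complex_of_real (r / (2 * p y)) *\<^sub>C y) = r / 2"
    using py r(1) unfolding p norm_of_real by simp
  then have "q (complex_of_real (r / (2 * p y)) *\<^sub>C y) \<le> 1" using r by simp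
  then show ?thesis using py r(1) unfolding q norm_of_real by (simp add: field_simps)
qed

text \<open>If f exceeded \<open>l\<close> somewhere on the unit ball of \<open>p l\<close> for
  every \<open>l\<close>, the chosen points would form a bounded sequence on which f is unbounded.
  Hence f is bounded on one of these balls, and homogeneity gives a seminorm estimate.\<close>

lemma frechet_continuous_functional:
  fixes f :: "'a::complex_algebra \<Rightarrow> complex"
  assumes p: "frechet_algebra p" and f: "clinear_on UNIV f"
    and bnd: "\<And>B. tvs_bounded (frechet_topology p) B \<Longrightarrow> \<exists>K. \<forall>x\<in>B. cmod (f x) \<le> K"
  shows "continuous_map (frechet_topology p) euclidean f"
proof -
  note D = frechet_algebraD[OF p]
  have mono: "p k x \<le> p l x" if "k \<le> l" for k l x
    using lift_Suc_mono_le[of "\<lambda>l. p l x", OF _ that] D(4) by blast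
  have "\<exists>l. \<forall>x. p l x < 1 \<longrightarrow> cmod (f x) \<le> real l"
  proof (rule ccontr)
    assume "\<nexists>l. \<forall>x. p l x < 1 \<longrightarrow> cmod (f x) \<le> real l"
    then obtain x where x: "\<And>l. p l (x l) < 1" "\<And>l. cmod (f (x l)) > real l"
      by (metis not_le)
    have "tvs_bounded (frechet_topology p) (range x)"
    proof (rule tvs_bounded_frechet[OF p])
      fix l
      \<comment> \<open>For k > l monotonicity gives \<open>p l (x k)\<close> \<le>
        \<open>p k (x k)\<close> < 1, so only the terms up to \<open>l\<close> need the
        maximum.\<close>
      have "p l (x k) \<le> Max ((\<lambda>k. p l (x k)) ` {..l}) + 1" for k
      proof (cases "k \<le> l")
        case True
        then have "p l (x k) \<le> Max ((\<lambda>k. p l (x k)) ` {..l})" by (intro Max_ge) auto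
        then show ?thesis by simp
      next
        case False
        have "0 \<le> p l (x 0)" using D(6) .
        also have "\<dots> \<le> Max ((\<lambda>k. p l (x k)) ` {..l})" by (intro Max_ge) auto
        finally show ?thesis using mono[of l k "x k"] x(1)[of k] False by simp
      qed
      then show "\<exists>K. \<forall>x\<in>range x. p l x \<le> K" by blast
    qed
    then obtain K where "\<And>l. cmod (f (x l)) \<le> K" using bnd by blast
    moreover obtain l where "K < real l" using reals_Archimedean2 by blast
    ultimately show False using x(2)[of l] by (meson not_le order_less_trans)
  qed
  then obtain l where l: "\<And>x. p l x < 1 \<Longrightarrow> cmod (f x) \<le> real l" by blast
  \<comment> \<open>Dividing by \<open>real l + 1\<close> and not by \<open>real l\<close>, since
    \<open>l\<close> may be 0.\<close>
  define q where "q x = cmod (f x) / (real l + 1)" for x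
  have q: "q y \<le> (2 / 1) * p l y" for y
  proof (rule seminorm_bound_from_nhd)
    show "q y \<le> 1" if "p l y < 1" for y using l[OF that] by (simp add: q_def)
  qed (use D clinear_onD[OF f] in \<open>auto simp: q_def norm_mult\<close>)
  have bound: "cmod (f y) \<le> (2 * (real l + 1)) * p l y" for y
    using q[of y] by (simp add: q_def field_simps)
  have "openin (frechet_topology p) {x \<in> UNIV. f x \<in> U}" if U: "open U" for U
  proof (subst openin_subopen, intro ballI)
    fix x assume "x \<in> {x \<in> UNIV. f x \<in> U}"
    then obtain e where e: "e > 0" "ball (f x) e \<subseteq> U" using U openE by blast
    define d where "d = e / (2 * (real l + 1))"
    have d: "d > 0" using e by (simp add: d_def)
    let ?V = "{y \<in> UNIV. p l (y - x) < d}"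
    have "f y \<in> U" if "y \<in> ?V" for y
    proof -
      have "f (y - x) = f y - f x"
        by (rule clinear_on_diff[OF f]) (auto simp: csubspace_set_def)
      moreover have "(2 * (real l + 1)) * p l (y - x) < e"
        using that by (simp add: d_def field_simps)
      ultimately have "cmod (f y - f x) < e" using bound[of "y - x"] by simp
      then show ?thesis using e(2) by (auto simp: dist_norm norm_minus_commute)
    qed
    moreover have "openin (frechet_topology p) ?V"
      unfolding frechet_topology_def by (rule openin_seminorm_ball) (use d in auto)
    ultimately show "\<exists>T. openin (frechet_topology p) T \<and> x \<in> T \<and> T \<subseteq> {x \<in> UNIV. f x \<in> U}"
      using d D(5) by (intro exI[of _ ?V]) auto
  qed
  then show ?thesis by (simp add: continuous_map_def)
qed

lemma csubspace_UNIV: "csubspace_set UNIV"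
  by (simp add: csubspace_set_def)

lemma wf_bimoduleD:
  assumes "wf_bimodule M"
  shows "csubspace_set (lcb_space M)"
    and "clinear_on (lcb_space M) (lact M b)" "clinear_on (lcb_space M) (\<lambda>x. ract M x b)"
    and "continuous_map (lcb_topology M) (lcb_topology M) (lact M b)"
    and "continuous_map (lcb_topology M) (lcb_topology M) (\<lambda>x. ract M x b)"
    and "x \<in> lcb_space M \<Longrightarrow> lact M b x \<in> lcb_space M"
    and "x \<in> lcb_space M \<Longrightarrow> ract M x b \<in> lcb_space M"
  using assms by (auto simp: wf_bimodule_def continuous_map_def Pi_iff)

section \<open>Coupled bimodules and their duals\<close>

text \<open>The properties of (\<iota>, \<tau>) that survive dualization.
  \<open>iota_bounded\<close> and \<open>tau_equicontinuous\<close> are phrased by bounded sets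
  because passing to the strong dual turns each into the other. \<open>zero_act\<close> is assumed
  because \<open>wf_bimodule\<close> has no linearity in the algebra variable.
  \<open>alternative\<close> records the parity of n.\<close>

locale coupled_bimodule =
  fixes p :: "nat \<Rightarrow> 'a::complex_algebra \<Rightarrow> real" and M :: "('a, 'x::complex_vector) lc_bimodule"
    and \<iota> :: "'a \<Rightarrow> 'x" and \<tau> :: "'a \<Rightarrow> 'x \<Rightarrow> complex"
  assumes frechet: "frechet_algebra p" and wf: "wf_bimodule M"
    and zero_act: "x \<in> lcb_space M \<Longrightarrow> lact M 0 x = 0" "x \<in> lcb_space M \<Longrightarrow> ract M x 0 = 0"
    and iota_linear: "clinear_on UNIV \<iota>" and iota_space: "\<iota> a \<in> lcb_space M"
    and iota_mult: "lact M a (\<iota> b) = \<iota> (a * b)" "ract M (\<iota> a) b = \<iota> (a * b)"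
    and iota_bounded: "tvs_bounded (frechet_topology p) B \<Longrightarrow> tvs_bounded (lcb_topology M) (\<iota> ` B)"
    and tau_linear: "clinear_on UNIV \<tau>" and tau_dual: "\<tau> a \<in> continuous_dual (lcb_topology M)"
    and tau_act: "x \<in> lcb_space M \<Longrightarrow> \<tau> a (lact M b x) = \<tau> (a * b) x"
      "x \<in> lcb_space M \<Longrightarrow> \<tau> a (ract M x b) = \<tau> (b * a) x"
    and tau_equicontinuous: "tvs_bounded (frechet_topology p) B \<Longrightarrow>
      \<exists>U. openin (lcb_topology M) U \<and> 0 \<in> U \<and> (\<forall>x\<in>U. \<forall>b\<in>B. cmod (\<tau> b x) \<le> 1)"
    and alternative: "(\<forall>a. \<iota> a = 0) \<or> (\<forall>a. \<tau> a = 0)"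
begin

lemmas space = wf_bimoduleD(1)[OF wf]

lemma tau_clinear: "clinear_on (lcb_space M) (\<tau> a)"
  using tau_dual[of a] by (simp add: continuous_dual_def)

text \<open>The neighbourhood on which all \<open>\<tau> b\<close> are at most 1 absorbs
  \<open>C\<close>, and the absorbing factor is the bound.\<close>

lemma tau_bounded:
  assumes "tvs_bounded (frechet_topology p) B" "tvs_bounded (lcb_topology M) C"
  shows "\<exists>K\<ge>0. \<forall>b\<in>B. \<forall>x\<in>C. cmod (\<tau> b x) \<le> K"
proof -
  obtain U where U: "openin (lcb_topology M) U" "0 \<in> U" "\<And>x b. x \<in> U \<Longrightarrow> b \<in> B \<Longrightarrow> cmod (\<tau> b x) \<le> 1"
    using tau_equicontinuous[OF assms(1)] by blast
  obtain s :: real where s: "s > 0" "C \<subseteq> scaleC (complex_of_real s) ` U"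
    using tvs_boundedE[OF assms(2) U(1,2)] .
  have "cmod (\<tau> b x) \<le> s" if b: "b \<in> B" and x: "x \<in> C" for b x
  proof -
    obtain u where u: "u \<in> U" "x = complex_of_real s *\<^sub>C u" using s(2) x by auto
    have "u \<in> lcb_space M" using openin_subset[OF U(1)] u(1) by auto
    then have "cmod (\<tau> b x) = s * cmod (\<tau> b u)"
      using s(1) by (simp add: u(2) clinear_onD(2)[OF tau_clinear] norm_mult)
    also have "\<dots> \<le> s * 1" using U(3)[OF u(1) b] s(1) by (intro mult_left_mono) auto
    finally show ?thesis by simp
  qed
  then show ?thesis using s(1) by (intro exI[of _ s]) auto
qed

end

text \<open>The canonical map into the bidual composed with \<iota>, set to 0 off the continuous
  dual in line with the convention for functionals.\<close>

definition evaluation :: "'x::complex_vector topology \<Rightarrow> ('a \<Rightarrow> 'x) \<Rightarrow> 'a \<Rightarrow> ('x \<Rightarrow> complex) \<Rightarrow> complex" where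
  "evaluation T \<iota> a f = (if f \<in> continuous_dual T then f (\<iota> a) else 0)"

lemma dual_bimodule_simps:
  "lcb_topology (dual_bimodule M) = strong_topology (lcb_topology M)"
  "lact (dual_bimodule M) b f x = (if x \<in> lcb_space M then f (ract M x b) else 0)"
  "ract (dual_bimodule M) f b x = (if x \<in> lcb_space M then f (lact M b x) else 0)"
  by (simp_all add: dual_bimodule_def)

lemma tvs_bounded_frechet_singleton:
  "frechet_algebra p \<Longrightarrow> tvs_bounded (frechet_topology p) {a}"
  by (rule tvs_bounded_frechet) auto

text \<open>The two maps exchange roles: \<open>tau_act\<close> yields the new
  \<open>iota_mult\<close> and \<open>iota_mult\<close> the new \<open>tau_act\<close>, uniform
  bounds for \<tau> on bounded sets make \<tau> a bounded map into the dual, and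
  \<open>alternative\<close> is symmetric.\<close>

lemma coupled_bimodule_dual:
  assumes "coupled_bimodule p M \<iota> \<tau>"
  shows "coupled_bimodule p (dual_bimodule M) \<tau> (evaluation (lcb_topology M) \<iota>)"
proof -
  interpret coupled_bimodule p M \<iota> \<tau> by fact
  let ?T = "lcb_topology M"
  have out: "f x = 0" if "f \<in> continuous_dual ?T" "x \<notin> topspace ?T" for f x
    using that by (auto simp: continuous_dual_def)
  have mem: "lact (dual_bimodule M) b f \<in> continuous_dual ?T"
    "ract (dual_bimodule M) f b \<in> continuous_dual ?T" if "f \<in> continuous_dual ?T" for b f
    using wf_bimoduleD(6,7)[OF wf_dual_bimodule[OF wf]] that by (simp_all add: dual_bimodule_simps(1))
  show ?thesis
  proof
    fix f assume "f \<in> lcb_space (dual_bimodule M)"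
    then have f: "f \<in> continuous_dual ?T" by (simp add: dual_bimodule_simps)
    show "lact (dual_bimodule M) 0 f = 0" "ract (dual_bimodule M) f 0 = 0"
      by (auto simp: dual_bimodule_simps fun_eq_iff zero_act continuous_dual_zero[OF f space])
    show "evaluation ?T \<iota> a (lact (dual_bimodule M) b f) = evaluation ?T \<iota> (a * b) f"
      "evaluation ?T \<iota> a (ract (dual_bimodule M) f b) = evaluation ?T \<iota> (b * a) f" for a b
      using f mem[OF f] by (simp_all add: evaluation_def dual_bimodule_simps iota_space iota_mult)
  next
    fix a b
    show "lact (dual_bimodule M) a (\<tau> b) = \<tau> (a * b)" "ract (dual_bimodule M) (\<tau> a) b = \<tau> (a * b)"
      by (auto simp: dual_bimodule_simps fun_eq_iff tau_act out[OF tau_dual])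
  next
    fix B assume B: "tvs_bounded (frechet_topology p) B"
    have "tvs_bounded (strong_topology ?T) (\<tau> ` B)"
      by (rule tvs_bounded_strong_topology[OF space]) (use tau_dual tau_bounded[OF B] in auto)
    then show "tvs_bounded (lcb_topology (dual_bimodule M)) (\<tau> ` B)" by (simp add: dual_bimodule_simps)
    have b: "tvs_bounded ?T (\<iota> ` B)" by (rule iota_bounded[OF B])
    let ?U = "{f \<in> continuous_dual ?T. dual_seminorm (\<iota> ` B) (f - 0) < 1}"
    have "openin (strong_topology ?T) ?U" by (rule openin_strong_ball[OF b]) auto
    moreover have "0 \<in> ?U" by simp
    moreover have "cmod (evaluation ?T \<iota> c f) \<le> 1" if "f \<in> ?U" "c \<in> B" for f c
      using dual_seminorm_upper[OF b _ space, of f "\<iota> c"] that by (simp add: evaluation_def)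
    ultimately show "\<exists>U. openin (lcb_topology (dual_bimodule M)) U \<and> 0 \<in> U \<and>
        (\<forall>f\<in>U. \<forall>b\<in>B. cmod (evaluation ?T \<iota> b f) \<le> 1)"
      unfolding dual_bimodule_simps by blast
  next
    fix a
    have b: "tvs_bounded ?T {\<iota> a}"
      using iota_bounded[OF tvs_bounded_frechet_singleton[OF frechet, of a]] by simp
    have "continuous_map (strong_topology ?T) euclidean (evaluation ?T \<iota> a)"
      by (rule continuous_map_eq[OF continuous_map_evaluation[OF b space]])
        (simp add: evaluation_def)
    then show "evaluation ?T \<iota> a \<in> continuous_dual (lcb_topology (dual_bimodule M))"
      using csubspace_setD[OF csubspace_set_continuous_dual[of ?T]]
      unfolding dual_bimodule_simps continuous_dual_def[of "strong_topology ?T"]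
      by (auto simp: clinear_on_def evaluation_def scaleC_fun_def)
  next
    show "clinear_on UNIV (evaluation ?T \<iota>)"
      using iota_linear iota_space
      by (auto simp: clinear_on_def evaluation_def fun_eq_iff continuous_dual_def scaleC_fun_def)
    show "(\<forall>a. \<tau> a = 0) \<or> (\<forall>a. evaluation ?T \<iota> a = 0)"
      using alternative continuous_dual_zero[OF _ space]
      by (auto simp: evaluation_def fun_eq_iff)
  qed (use frechet wf_dual_bimodule[OF wf] tau_linear tau_dual in \<open>auto simp: dual_bimodule_simps\<close>)
qed

section \<open>The iterated duals of the unitization\<close>

definition unitization_bimodule ::
  "('a::complex_algebra, 'x::complex_vector) lc_bimodule \<Rightarrow> ('a \<Rightarrow> 'x) \<Rightarrow> ('a \<Rightarrow> 'x \<Rightarrow> complex) \<Rightarrow>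
    ('a unitization, 'x \<times> complex) lc_bimodule" where
  "unitization_bimodule M \<iota> \<tau> =
     \<lparr>lcb_topology = prod_topology (lcb_topology M) euclidean,
      lact = (\<lambda>b z. (lact M (algebra_part b) (fst z) + scalar_part b *\<^sub>C fst z
                 + snd z *\<^sub>C \<iota> (algebra_part b),
               \<tau> (algebra_part b) (fst z) + scalar_part b * snd z)),
      ract = (\<lambda>z b. (ract M (fst z) (algebra_part b) + scalar_part b *\<^sub>C fst z
                 + snd z *\<^sub>C \<iota> (algebra_part b),
               \<tau> (algebra_part b) (fst z) + scalar_part b * snd z))\<rparr>"

lemma unitization_bimodule_simps:
  "lcb_topology (unitization_bimodule M \<iota> \<tau>) = prod_topology (lcb_topology M) euclidean"
  "lact (unitization_bimodule M \<iota> \<tau>) b z =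
    (lact M (algebra_part b) (fst z) + scalar_part b *\<^sub>C fst z + snd z *\<^sub>C \<iota> (algebra_part b),
     \<tau> (algebra_part b) (fst z) + scalar_part b * snd z)"
  "ract (unitization_bimodule M \<iota> \<tau>) z b =
    (ract M (fst z) (algebra_part b) + scalar_part b *\<^sub>C fst z + snd z *\<^sub>C \<iota> (algebra_part b),
     \<tau> (algebra_part b) (fst z) + scalar_part b * snd z)"
  by (simp_all add: unitization_bimodule_def)

text \<open>Iterated duals are given only as copies, so a coupling must move along an isomorphism
  \<phi>: \<iota> is composed with \<phi>, \<tau> with its inverse, and \<phi> times the identity is
  the isomorphism of the unitized bimodules.\<close>

lemma unitization_bimodule_transport:
  assumes "coupled_bimodule p M \<iota> \<tau>" and "lcb_isomorphic M N"
  obtains \<kappa> \<sigma> where "coupled_bimodule p N \<kappa> \<sigma>"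
    "lcb_isomorphic (unitization_bimodule M \<iota> \<tau>) (unitization_bimodule N \<kappa> \<sigma>)"
proof -
  interpret coupled_bimodule p M \<iota> \<tau> by fact
  obtain \<phi> where phi: "lcb_iso \<phi> M N" using assms(2) by (auto simp: lcb_isomorphic_def)
  obtain \<psi> where psi: "lcb_iso \<psi> N M"
    and h: "homeomorphic_maps (lcb_topology M) (lcb_topology N) \<phi> \<psi>" and wfN: "wf_bimodule N"
    using lcb_iso_inverse[OF phi wf] .
  have c: "continuous_map (lcb_topology M) (lcb_topology N) \<phi>"
      "continuous_map (lcb_topology N) (lcb_topology M) \<psi>"
    and inv: "\<And>x. x \<in> lcb_space M \<Longrightarrow> \<psi> (\<phi> x) = x" "\<And>y. y \<in> lcb_space N \<Longrightarrow> \<phi> (\<psi> y) = y"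
    using h by (auto simp: homeomorphic_maps_def)
  have m: "\<And>x. x \<in> lcb_space M \<Longrightarrow> \<phi> x \<in> lcb_space N" "\<And>y. y \<in> lcb_space N \<Longrightarrow> \<psi> y \<in> lcb_space M"
    using c by (auto simp: continuous_map_def)
  have lin: "clinear_on (lcb_space M) \<phi>" "clinear_on (lcb_space N) \<psi>"
    and phi_act: "\<And>b x. x \<in> lcb_space M \<Longrightarrow> \<phi> (lact M b x) = lact N b (\<phi> x)"
      "\<And>b x. x \<in> lcb_space M \<Longrightarrow> \<phi> (ract M x b) = ract N (\<phi> x) b"
    and psi_act: "\<And>b y. y \<in> lcb_space N \<Longrightarrow> \<psi> (lact N b y) = lact M b (\<psi> y)"
      "\<And>b y. y \<in> lcb_space N \<Longrightarrow> \<psi> (ract N y b) = ract M (\<psi> y) b"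
    using phi psi by (auto simp: lcb_iso_def)
  note spaceN = wf_bimoduleD(1)[OF wfN] and actN = wf_bimoduleD(6,7)[OF wfN]
  note actM = wf_bimoduleD(6,7)[OF wf]
  define \<kappa> where "\<kappa> = (\<lambda>a. \<phi> (\<iota> a))"
  define \<sigma> where "\<sigma> = (\<lambda>a. adjoint_on (lcb_space N) \<psi> (\<tau> a))"
  have zero: "\<phi> 0 = 0" "\<psi> 0 = 0"
    using clinear_on_zero[OF lin(1) space] clinear_on_zero[OF lin(2) spaceN] by auto
  have "coupled_bimodule p N \<kappa> \<sigma>"
  proof
    fix x assume x: "x \<in> lcb_space N"
    have "lact N 0 x = \<phi> (lact M 0 (\<psi> x))" "ract N x 0 = \<phi> (ract M (\<psi> x) 0)"
      using x by (simp_all add: phi_act m inv)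
    then show "lact N 0 x = 0" "ract N x 0 = 0"
      using x by (simp_all add: zero_act m zero)
    show "\<sigma> a (lact N b x) = \<sigma> (a * b) x" "\<sigma> a (ract N x b) = \<sigma> (b * a) x" for a b
      using x by (simp_all add: \<sigma>_def adjoint_on_def actN psi_act tau_act m)
  next
    fix B assume B: "tvs_bounded (frechet_topology p) B"
    show "tvs_bounded (lcb_topology N) (\<kappa> ` B)"
      using tvs_bounded_image[OF iota_bounded[OF B] c(1) lin(1) space] by (simp add: \<kappa>_def image_image)
    obtain U where U: "openin (lcb_topology M) U" "0 \<in> U" "\<forall>x\<in>U. \<forall>b\<in>B. cmod (\<tau> b x) \<le> 1"
      using tau_equicontinuous[OF B] by blast
    have "openin (lcb_topology N) {y \<in> lcb_space N. \<psi> y \<in> U}"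
      using c(2) U(1) by (auto simp: continuous_map_def)
    then show "\<exists>U. openin (lcb_topology N) U \<and> 0 \<in> U \<and> (\<forall>x\<in>U. \<forall>b\<in>B. cmod (\<sigma> b x) \<le> 1)"
      using U(2,3) csubspace_setD(1)[OF spaceN]
      by (intro exI[of _ "{y \<in> lcb_space N. \<psi> y \<in> U}"]) (auto simp: zero \<sigma>_def adjoint_on_def)
  next
    show "clinear_on UNIV \<kappa>" "clinear_on UNIV \<sigma>"
      using iota_linear tau_linear
      by (auto simp: \<kappa>_def \<sigma>_def clinear_on_def iota_space clinear_onD[OF lin(1)] adjoint_on_def
          fun_eq_iff scaleC_fun_def)
    show "(\<forall>a. \<kappa> a = 0) \<or> (\<forall>a. \<sigma> a = 0)"
      using alternative by (auto simp: \<kappa>_def \<sigma>_def zero adjoint_on_def fun_eq_iff)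
    show "\<sigma> a \<in> continuous_dual (lcb_topology N)" for a
      using adjoint_on(2)[OF c(2) lin(2) spaceN space] tau_dual[of a]
      by (auto simp: \<sigma>_def continuous_map_def)
    show "lact N a (\<kappa> b) = \<kappa> (a * b)" "ract N (\<kappa> a) b = \<kappa> (a * b)" for a b
      using phi_act[OF iota_space, of a b] phi_act(2)[OF iota_space, of a b] by (simp_all add: \<kappa>_def iota_mult)
  qed (use frechet wfN iota_space m in \<open>auto simp: \<kappa>_def\<close>)
  moreover have "lcb_iso (\<lambda>(x, l). (\<phi> x, l)) (unitization_bimodule M \<iota> \<tau>) (unitization_bimodule N \<kappa> \<sigma>)"
    unfolding lcb_iso_def
  proof (intro conjI allI ballI)
    have "homeomorphic_maps (prod_topology (lcb_topology M) euclidean)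
      (prod_topology (lcb_topology N) euclidean) (\<lambda>(x, l :: complex). (\<phi> x, id l)) (\<lambda>(x, l). (\<psi> x, id l))"
      unfolding homeomorphic_maps_prod using h by (auto simp: homeomorphic_maps_def)
    then show "homeomorphic_map (lcb_topology (unitization_bimodule M \<iota> \<tau>))
        (lcb_topology (unitization_bimodule N \<kappa> \<sigma>)) (\<lambda>(x, l). (\<phi> x, l))"
      using homeomorphic_maps_imp_map by (fastforce simp: unitization_bimodule_simps)
    show "clinear_on (lcb_space (unitization_bimodule M \<iota> \<tau>)) (\<lambda>(x, l). (\<phi> x, l))"
      by (auto simp: clinear_on_def unitization_bimodule_simps scaleC_prod_def clinear_onD[OF lin(1)])
    fix b z assume z: "z \<in> lcb_space (unitization_bimodule M \<iota> \<tau>)"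
    then show "(case lact (unitization_bimodule M \<iota> \<tau>) b z of (x, l) \<Rightarrow> (\<phi> x, l)) =
        lact (unitization_bimodule N \<kappa> \<sigma>) b (case z of (x, l) \<Rightarrow> (\<phi> x, l))"
      "(case ract (unitization_bimodule M \<iota> \<tau>) z b of (x, l) \<Rightarrow> (\<phi> x, l)) =
        ract (unitization_bimodule N \<kappa> \<sigma>) (case z of (x, l) \<Rightarrow> (\<phi> x, l)) b"
      by (auto simp: unitization_bimodule_simps clinear_onD[OF lin(1)] csubspace_setD[OF space] actM
          iota_space phi_act \<kappa>_def \<sigma>_def adjoint_on_def m inv)
  qed
  ultimately show ?thesis using that by (auto simp: lcb_isomorphic_def)
qed

section \<open>The regular bimodule of the unitization, the passage to its dual, and the induction
  on n\<close>

lemma coupled_bimodule_regular: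
  assumes p: "frechet_algebra p"
  shows "coupled_bimodule p (regular_bimodule p) (\<lambda>a. a) (\<lambda>a. 0)"
proof
  fix B
  show "\<exists>U. openin (lcb_topology (regular_bimodule p)) U \<and> 0 \<in> U \<and>
      (\<forall>x\<in>U. \<forall>b\<in>B. cmod ((0 :: 'a \<Rightarrow> complex) x) \<le> 1)"
    \<comment> \<open>As \<tau> = 0, the whole space serves as the neighbourhood.\<close>
    by (intro exI[of _ "lcb_space (regular_bimodule p)"] conjI openin_topspace)
      (auto simp: regular_bimodule_def)
qed (use p wf_regular_bimodule[OF p] in \<open>auto simp: regular_bimodule_def clinear_on_def\<close>)

lemma continuous_map_algebra_part:
  fixes p :: "nat \<Rightarrow> 'a::complex_algebra \<Rightarrow> real"
  assumes p: "frechet_algebra p"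
  shows "continuous_map (frechet_topology (unitization_seminorms p)) (frechet_topology p) algebra_part"
  unfolding frechet_topology_def
proof (rule continuous_map_seminorm_topology)
  let ?q = "unitization_seminorms p"
  fix q assume "q \<in> range p"
  then obtain l where "q = p l" by auto
  then show "\<exists>q'\<in>range ?q. \<exists>C>0. \<forall>x\<in>UNIV. \<forall>y\<in>UNIV. q (algebra_part x - algebra_part y) \<le> C * q' (x - y)"
    by (intro bexI[of _ "?q l"] exI[of _ 1]) (auto simp: unitization_seminorms_def minus_unitization_def)
qed (use frechet_algebraD(7)[OF p] frechet_algebraD(5)[OF frechet_algebra_unitization[OF p]] in auto)

lemma continuous_map_Unitization:
  fixes p :: "nat \<Rightarrow> 'a::complex_algebra \<Rightarrow> real"
  assumes p: "frechet_algebra p"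
  shows "continuous_map (frechet_topology p) (frechet_topology (unitization_seminorms p))
    (\<lambda>a. Unitization a 0)"
  unfolding frechet_topology_def
proof (rule continuous_map_seminorm_topology)
  let ?q = "unitization_seminorms p"
  fix q assume "q \<in> range ?q"
  then obtain l where "q = ?q l" by auto
  then show "\<exists>q'\<in>range p. \<exists>C>0. \<forall>x\<in>UNIV. \<forall>y\<in>UNIV.
      q (Unitization x 0 - Unitization y 0) \<le> C * q' (x - y)"
    by (intro bexI[of _ "p l"] exI[of _ 1]) (auto simp: unitization_seminorms_def minus_unitization_def)
qed (use frechet_algebraD(5)[OF p] frechet_algebraD(7)[OF frechet_algebra_unitization[OF p]] in auto)

text \<open>The seminorms of the unitization generate the product topology, and its multiplication
  is the coupled action with \<iota> the identity and \<tau> = 0.\<close>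

lemma unitization_bimodule_regular:
  assumes p: "frechet_algebra p"
  shows "lcb_isomorphic (regular_bimodule (unitization_seminorms p))
    (unitization_bimodule (regular_bimodule p) (\<lambda>a. a) (\<lambda>a. 0))"
proof -
  let ?q = "unitization_seminorms p"
  let ?f = "\<lambda>b. (algebra_part b, scalar_part b)"
  note D = frechet_algebraD[OF p] and E = frechet_algebraD[OF frechet_algebra_unitization[OF p]]
  have "continuous_map (frechet_topology ?q) (frechet_topology p) algebra_part"
    by (rule continuous_map_algebra_part[OF p])
  \<comment> \<open>A bounded set is absorbed by the unit ball of \<open>?q 0\<close>, on which the
    scalar part is at most 1.\<close>
  moreover have "continuous_map (frechet_topology ?q) euclidean (scalar_part :: 'a unitization \<Rightarrow> complex)"
  proof (rule frechet_continuous_functional[OF frechet_algebra_unitization[OF p]])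
    fix B assume B: "tvs_bounded (frechet_topology ?q) B"
    have "openin (frechet_topology ?q) {x \<in> UNIV. ?q 0 (x - 0) < 1}"
      unfolding frechet_topology_def by (rule openin_seminorm_ball) auto
    then obtain s :: real where s: "s > 0" "B \<subseteq> scaleC (complex_of_real s) ` {x \<in> UNIV. ?q 0 (x - 0) < 1}"
      by (rule tvs_boundedE[OF B]) (use E(5) in auto)
    have "cmod (scalar_part u) \<le> 1" if "?q 0 (u - 0) < 1" for u
      using that D(6)[of 0 "algebra_part u"] by (simp add: unitization_seminorms_def)
    then have "cmod (scalar_part x) \<le> s * 1" if "x \<in> B" for x
      using s that by (fastforce simp: scaleC_unitization_def norm_mult intro!: mult_left_mono)
    then show "\<exists>K. \<forall>x\<in>B. cmod (scalar_part x) \<le> K" by blast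
  qed (auto simp: clinear_on_def plus_unitization_def scaleC_unitization_def)
  ultimately have f: "continuous_map (frechet_topology ?q) (prod_topology (frechet_topology p) euclidean) ?f"
    by (rule continuous_map_pairedI)
  have g: "continuous_map (prod_topology (frechet_topology p) euclidean) (frechet_topology ?q)
      (\<lambda>z. Unitization (fst z) (snd z))"
    unfolding frechet_topology_def[of ?q]
  proof (rule continuous_map_into_seminorm_topology)
    fix q and z :: "'a \<times> complex" and e :: real assume "q \<in> range ?q" and e: "e > 0"
    then obtain l where l: "q = ?q l" by auto
    let ?V = "{y \<in> UNIV. p l (y - fst z) < e / 2} \<times> ball (snd z) (e / 2)"
    have "openin (frechet_topology p) {y \<in> UNIV. p l (y - fst z) < e / 2}"
      unfolding frechet_topology_def by (rule openin_seminorm_ball) (use e in auto)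
    then have "openin (prod_topology (frechet_topology p) euclidean) ?V"
      by (simp add: openin_prod_Times_iff)
    moreover have "z \<in> ?V" using e D(5) by (cases z) auto
    moreover have "q (Unitization (fst y) (snd y) - Unitization (fst z) (snd z)) < e" if "y \<in> ?V"
      for y :: "'a \<times> complex"
      using that by (auto simp: l unitization_seminorms_def minus_unitization_def dist_norm
          norm_minus_commute[of "snd z"])
    ultimately show "\<exists>V. openin (prod_topology (frechet_topology p) euclidean) V \<and> z \<in> V \<and>
        (\<forall>y\<in>V. q (Unitization (fst y) (snd y) - Unitization (fst z) (snd z)) < e)"
      by blast
  qed (use E(7) in auto)
  have "homeomorphic_maps (frechet_topology ?q) (prod_topology (frechet_topology p) euclidean)
      ?f (\<lambda>z. Unitization (fst z) (snd z))"
    using f g by (simp add: homeomorphic_maps_def)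
  then have "lcb_iso ?f (regular_bimodule ?q) (unitization_bimodule (regular_bimodule p) (\<lambda>a. a) (\<lambda>a. 0))"
    unfolding lcb_iso_def
    by (auto simp: homeomorphic_maps_map regular_bimodule_def unitization_bimodule_simps clinear_on_def
        plus_unitization_def scaleC_unitization_def times_unitization_def scaleC_prod_def algebra_simps)
  then show ?thesis by (auto simp: lcb_isomorphic_def)
qed

lemma tvs_bounded_complex_functional:
  assumes "tvs_bounded T B" "f \<in> continuous_dual T" "csubspace_set (topspace T)"
  obtains K where "K \<ge> 0" "\<And>x. x \<in> B \<Longrightarrow> cmod (f x) \<le> K"
  using that[OF dual_seminorm_nonneg[OF assms] dual_seminorm_upper[OF assms]] .

text \<open>A functional on the product is determined by its restriction to M and its value at (0,
  1). Transposing the action swaps the \<iota> term and the \<tau> term; these are the same on the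
  left and on the right, so both dual actions take the coupled form.\<close>

lemma unitization_bimodule_dual:
  assumes "coupled_bimodule p M \<iota> \<tau>"
  shows "lcb_isomorphic (dual_bimodule (unitization_bimodule M \<iota> \<tau>))
    (unitization_bimodule (dual_bimodule M) \<tau> (evaluation (lcb_topology M) \<iota>))"
proof -
  interpret coupled_bimodule p M \<iota> \<tau> by fact
  let ?T = "lcb_topology M" and ?S = "lcb_space M"
  let ?E = "prod_topology ?T (euclidean :: complex topology)"
  let ?f = "\<lambda>f. (adjoint_on ?S (\<lambda>x. (x, 0 :: complex)) f, f (0, 1 :: complex))"
  let ?g = "\<lambda>h z. if z \<in> topspace ?E then fst h (fst z) + snd h * snd z else 0"
  have spaceE: "csubspace_set (topspace ?E)"
    using space by (auto simp: csubspace_set_def scaleC_prod_def zero_prod_def)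
  have inl: "continuous_map ?T ?E (\<lambda>x. (x, 0 :: complex))" "clinear_on ?S (\<lambda>x. (x, 0 :: complex))"
    by (auto intro!: continuous_map_pairedI simp: clinear_on_def scaleC_prod_def)
  have fst_linear: "clinear_on (topspace ?E) fst"
    by (auto simp: clinear_on_def scaleC_prod_def)
  \<comment> \<open>Needed for the continuity of the second coordinate, evaluation at (0, 1). Only
    the scalar factor has to be absorbed, since 0 lies in every neighbourhood from the first
    factor.\<close>
  have point: "tvs_bounded ?E {(0, 1)}"
    unfolding tvs_bounded_def
  proof (intro conjI allI impI)
    show "{(0, 1)} \<subseteq> topspace ?E" using csubspace_setD(1)[OF space] by auto
    fix W assume "openin ?E W \<and> 0 \<in> W"
    then obtain U V where W: "openin ?T U" "openin euclidean V" "0 \<in> U" "0 \<in> V" "U \<times> V \<subseteq> W"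
      unfolding openin_prod_topology_alt zero_prod_def by blast
    then obtain e where e: "e > 0" "ball 0 e \<subseteq> V" by (auto elim: openE)
    have "(0, 1) \<in> scaleC (complex_of_real t) ` W" if t: "t > 1 / e" for t
    proof -
      have t0: "t > 0" using t e(1) by (meson divide_pos_pos less_trans zero_less_one)
      have "1 / t < e" using t e(1) t0 by (simp add: field_simps)
      then have "complex_of_real (1 / t) \<in> V" using e(2) t0 by (auto simp: norm_divide)
      then have "(0, complex_of_real (1 / t)) \<in> W" using W by auto
      moreover have "(0, 1) = complex_of_real t *\<^sub>C (0 :: 'b, complex_of_real (1 / t))"
        using t0 by (simp add: scaleC_prod_def)
      ultimately show ?thesis by blast
    qed
    then show "\<exists>s>0. \<forall>t>s. {(0, 1)} \<subseteq> scaleC (complex_of_real t) ` W"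
      using e(1) by (intro exI[of _ "1 / e"]) auto
  qed
  have f: "continuous_map (strong_topology ?E) (prod_topology (strong_topology ?T) euclidean) ?f"
    by (intro continuous_map_pairedI adjoint_on(2)[OF inl space spaceE]
        continuous_map_evaluation[OF point spaceE])
  have gE: "?g h \<in> continuous_dual ?E" if h: "h \<in> continuous_dual ?T \<times> UNIV" for h
  proof -
    have "continuous_map ?T euclidean (fst h)" using h by (auto simp: continuous_dual_def)
    then have 1: "continuous_map ?E euclidean (fst h \<circ> fst)"
      by (rule continuous_map_compose[OF continuous_map_fst])
    have "continuous_map euclidean euclidean (\<lambda>x. snd h * x)"
      by (simp add: continuous_on_mult_left)
    then have 2: "continuous_map ?E euclidean ((\<lambda>x. snd h * x) \<circ> snd)"
      by (rule continuous_map_compose[OF continuous_map_snd])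
    have "continuous_map ?E euclidean (?g h)"
      by (rule continuous_map_eq[OF continuous_map_add[OF 1 2]]) auto
    moreover have "clinear_on (topspace ?E) (?g h)"
      using h csubspace_setD[OF space]
      by (auto simp: clinear_on_def scaleC_prod_def continuous_dual_def algebra_simps)
    ultimately show ?thesis by (auto simp: continuous_dual_def)
  qed
  \<comment> \<open>As a continuous functional, the scalar coordinate is bounded on bounded sets;
    this supplies \<open>K\<close> below.\<close>
  have snd_dual: "(\<lambda>z. if z \<in> topspace ?E then snd z else 0) \<in> continuous_dual ?E"
    using gE[of "(0, 1)"] by (simp cong: if_cong)
  have g: "continuous_map (prod_topology (strong_topology ?T) euclidean) (strong_topology ?E) ?g"
    unfolding strong_topology_def[of ?E]
  proof (rule continuous_map_into_seminorm_topology)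
    fix h assume "h \<in> topspace (prod_topology (strong_topology ?T) (euclidean :: complex topology))"
    then show "?g h \<in> continuous_dual ?E" using gE by simp
  next
    fix q f g h assume "q \<in> {dual_seminorm B |B. tvs_bounded ?E B}"
      "f \<in> continuous_dual ?E" "g \<in> continuous_dual ?E" "h \<in> continuous_dual ?E"
    then show "q (f - h) \<le> q (f - g) + q (g - h)" using dual_seminorm_triangle[OF _ spaceE] by blast
  next
    fix q h and e :: real
    assume "q \<in> {dual_seminorm B |B. tvs_bounded ?E B}" and e: "e > 0"
      and "h \<in> topspace (prod_topology (strong_topology ?T) (euclidean :: complex topology))"
    then obtain B where B: "tvs_bounded ?E B" "q = dual_seminorm B"
      and h: "fst h \<in> continuous_dual ?T" by auto
    have BE: "B \<subseteq> topspace ?E" using B(1) by (simp add: tvs_bounded_def)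
    have C: "tvs_bounded ?T (fst ` B)"
      by (rule tvs_bounded_image[OF B(1) continuous_map_fst fst_linear spaceE])
    obtain K where K: "K \<ge> 0" "\<And>z. z \<in> B \<Longrightarrow> cmod (if z \<in> topspace ?E then snd z else 0) \<le> K"
      by (rule tvs_bounded_complex_functional[OF B(1) snd_dual spaceE]) blast
    let ?U = "{k \<in> continuous_dual ?T. dual_seminorm (fst ` B) (k - fst h) < e / 4}"
    \<comment> \<open>Each coordinate contributes at most e/4 on \<open>B\<close>, where the scalar
      coordinate is bounded by \<open>K\<close>; the sum e/2 leaves room for a strict inequality
      after the supremum. \<open>K + 1\<close> avoids division by 0.\<close>
    let ?V = "?U \<times> ball (snd h) (e / (4 * (K + 1)))"
    have "openin (prod_topology (strong_topology ?T) euclidean) ?V"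
      using openin_strong_ball[OF C h, of "e / 4"] e by (simp add: openin_prod_Times_iff)
    moreover have "h \<in> ?V" using h e K(1) by (cases h) auto
    moreover have "q (?g k - ?g h) < e" if k: "k \<in> ?V" for k
    proof -
      have "q (?g k - ?g h) \<le> e / 2"
        unfolding B(2)
      proof (rule dual_seminorm_least)
        fix z assume z: "z \<in> B"
        have kh: "fst k - fst h \<in> continuous_dual ?T"
          using csubspace_setD(4)[OF csubspace_set_continuous_dual] k h by auto
        have "cmod ((fst k - fst h) (fst z)) \<le> dual_seminorm (fst ` B) (fst k - fst h)"
          by (rule dual_seminorm_upper[OF C kh space]) (use z in auto)
        also have "\<dots> \<le> e / 4" using k by auto
        finally have 1: "cmod (fst k (fst z) - fst h (fst z)) \<le> e / 4" by simp
        have "cmod (snd k - snd h) \<le> e / (4 * (K + 1))"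
          using k by (auto simp: dist_norm norm_minus_commute)
        moreover have "cmod (snd z) \<le> K + 1" using K(2)[OF z] z BE by (auto split: if_splits)
        ultimately have "cmod ((snd k - snd h) * snd z) \<le> e / (4 * (K + 1)) * (K + 1)"
          unfolding norm_mult using K(1) e by (intro mult_mono) auto
        also have "\<dots> = e / 4" using K(1) by (simp add: field_simps)
        finally have 2: "cmod ((snd k - snd h) * snd z) \<le> e / 4" .
        have "(?g k - ?g h) z = (fst k (fst z) - fst h (fst z)) + (snd k - snd h) * snd z"
          using z BE by (auto simp: algebra_simps)
        then show "cmod ((?g k - ?g h) z) \<le> e / 2"
          using norm_triangle_ineq[of "fst k (fst z) - fst h (fst z)" "(snd k - snd h) * snd z"] 1 2
          by simp
      qed (use k e continuous_dual_zero[OF _ space, of "fst k"] continuous_dual_zero[OF h space]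
          in \<open>auto simp: zero_prod_def\<close>)
      then show ?thesis using e by simp
    qed
    ultimately show "\<exists>V. openin (prod_topology (strong_topology ?T) euclidean) V \<and> h \<in> V \<and>
        (\<forall>k\<in>V. q (?g k - ?g h) < e)"
      by blast
  qed
  have split: "f (x, l) = f (x, 0) + f (0, 1) * l"
    if "f \<in> continuous_dual ?E" "x \<in> ?S" for f :: "'b \<times> complex \<Rightarrow> complex" and x l
  proof -
    have lin: "clinear_on (topspace ?E) f" using that(1) by (simp add: continuous_dual_def)
    have "(x, 0) \<in> topspace ?E" "(0, 1) \<in> topspace ?E" "(0, l) \<in> topspace ?E"
      using that(2) csubspace_setD(1)[OF space] by auto
    then show ?thesis
      using clinear_onD(1)[OF lin, of "(x, 0)" "(0, l)"] clinear_onD(2)[OF lin, of "(0, 1)" l]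
      by (simp add: scaleC_prod_def)
  qed
  have "homeomorphic_maps (strong_topology ?E) (prod_topology (strong_topology ?T) euclidean) ?f ?g"
    unfolding homeomorphic_maps_def
  proof (intro conjI f g ballI)
    fix f assume "f \<in> topspace (strong_topology ?E)"
    then have f: "f \<in> continuous_dual ?E" by simp
    show "?g (?f f) = f"
    proof
      fix z
      show "?g (?f f) z = f z"
      proof (cases "z \<in> topspace ?E")
        case True
        then show ?thesis using split[OF f, of "fst z" "snd z"] by (cases z) (simp add: adjoint_on_def)
      next
        case False
        then show ?thesis using f by (cases z) (auto simp: continuous_dual_def)
      qed
    qed
  next
    fix h assume "h \<in> topspace (prod_topology (strong_topology ?T) (euclidean :: complex topology))"
    then have h: "fst h \<in> continuous_dual ?T" by auto
    then have "fst h x = 0" if "x \<notin> ?S" for x using that by (simp add: continuous_dual_def)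
    then show "?f (?g h) = h"
      using csubspace_setD(1)[OF space] continuous_dual_zero[OF h space]
      by (intro prod_eqI) (auto simp: adjoint_on_def fun_eq_iff)
  qed
  moreover have "clinear_on (continuous_dual ?E) ?f"
    by (auto simp: clinear_on_def adjoint_on_def scaleC_prod_def scaleC_fun_def fun_eq_iff)
  moreover
  have act: "?f (lact (dual_bimodule (unitization_bimodule M \<iota> \<tau>)) b f) =
      lact (unitization_bimodule (dual_bimodule M) \<tau> (evaluation ?T \<iota>)) b (?f f)"
    "?f (ract (dual_bimodule (unitization_bimodule M \<iota> \<tau>)) f b) =
      ract (unitization_bimodule (dual_bimodule M) \<tau> (evaluation ?T \<iota>)) (?f f) b"
    if f: "f \<in> continuous_dual ?E" for b f
  proof -
    let ?a = "algebra_part b" and ?\<mu> = "scalar_part b"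
    have lin: "clinear_on (topspace ?E) f" using f by (simp add: continuous_dual_def)
    have S: "0 \<in> ?S" by (rule csubspace_setD(1)[OF space])
    \<comment> \<open>Linearity in exactly the shape in which the transposed actions present their
      arguments.\<close>
    have scal: "f (x + ?\<mu> *\<^sub>C y, l) = f (x, 0) + ?\<mu> * f (y, 0) + f (0, 1) * l"
      if "x \<in> ?S" "y \<in> ?S" for x y l
    proof -
      have "f (x + ?\<mu> *\<^sub>C y, l) = f (x + ?\<mu> *\<^sub>C y, 0) + f (0, 1) * l"
        by (rule split[OF f]) (use that csubspace_setD[OF space] in auto)
      moreover have "f (x + ?\<mu> *\<^sub>C y, 0) = f (x, 0) + f (?\<mu> *\<^sub>C y, 0)"
        using clinear_onD(1)[OF lin, of "(x, 0)" "(?\<mu> *\<^sub>C y, 0)"] that csubspace_setD[OF space] by simp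
      moreover have "f (?\<mu> *\<^sub>C y, 0) = ?\<mu> * f (y, 0)"
        using clinear_onD(2)[OF lin, of "(y, 0)" ?\<mu>] that by (simp add: scaleC_prod_def)
      ultimately show ?thesis by simp
    qed
    have adj: "adjoint_on ?S (\<lambda>x. (x, 0)) f \<in> continuous_dual ?T"
      using adjoint_on(2)[OF inl space spaceE] f by (auto simp: continuous_map_def)
    have act0: "lact M ?a 0 = 0" "ract M 0 ?a = 0"
      using clinear_on_zero[OF wf_bimoduleD(2)[OF wf] space]
        clinear_on_zero[OF wf_bimoduleD(3)[OF wf] space] by auto
    have unit: "f (\<iota> ?a, ?\<mu>) = f (\<iota> ?a, 0) + f (0, 1) * ?\<mu>"
      by (rule split[OF f iota_space])
    have tau0: "\<tau> ?a 0 = 0" "\<And>x. x \<notin> ?S \<Longrightarrow> \<tau> ?a x = 0"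
      using continuous_dual_zero[OF tau_dual space] tau_dual[of ?a] by (auto simp: continuous_dual_def)
    show "?f (lact (dual_bimodule (unitization_bimodule M \<iota> \<tau>)) b f) =
        lact (unitization_bimodule (dual_bimodule M) \<tau> (evaluation ?T \<iota>)) b (?f f)"
      "?f (ract (dual_bimodule (unitization_bimodule M \<iota> \<tau>)) f b) =
        ract (unitization_bimodule (dual_bimodule M) \<tau> (evaluation ?T \<iota>)) (?f f) b"
      using S adj
      by (auto simp: unitization_bimodule_simps dual_bimodule_simps adjoint_on_def evaluation_def
          fun_eq_iff scaleC_fun_def scal wf_bimoduleD(6,7)[OF wf] tau0 act0 iota_space unit)
  qed
  ultimately have "lcb_iso ?f (dual_bimodule (unitization_bimodule M \<iota> \<tau>))
      (unitization_bimodule (dual_bimodule M) \<tau> (evaluation ?T \<iota>))"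
    unfolding lcb_iso_def
    by (auto simp: homeomorphic_maps_map dual_bimodule_simps(1) unitization_bimodule_simps(1)
       simp del: topspace_prod_topology)
  then show ?thesis by (auto simp: lcb_isomorphic_def)
qed

text \<open>Induction along the tower of copies for \<open>p\<close>. The coupling is existential
  because each transport to the next copy changes it; the copies for the unitization live in the
  larger ambient space \<open>'u \<times> complex\<close>.\<close>

lemma iterated_dual_unitization:
  fixes p :: "nat \<Rightarrow> 'a::complex_algebra \<Rightarrow> real" and M :: "('a, 'u::complex_vector) lc_bimodule"
  assumes p: "frechet_algebra p" and M: "iterated_dual p n M"
  shows "\<exists>\<iota> \<tau>. coupled_bimodule p M \<iota> \<tau> \<and>
    iterated_dual (unitization_seminorms p) n (unitization_bimodule M \<iota> \<tau>)"
  using M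
proof (induction n arbitrary: M)
  case 0
  then have "lcb_isomorphic (regular_bimodule p) M" by simp
  from unitization_bimodule_transport[OF coupled_bimodule_regular[OF p] this]
  obtain \<iota> \<tau> where *: "coupled_bimodule p M \<iota> \<tau>"
    "lcb_isomorphic (unitization_bimodule (regular_bimodule p) (\<lambda>a. a) (\<lambda>a. 0)) (unitization_bimodule M \<iota> \<tau>)"
    by metis
  then show ?case
    using lcb_isomorphic_trans[OF unitization_bimodule_regular[OF p] *(2)] by auto
next
  case (Suc n)
  then obtain M' :: "('a, 'u) lc_bimodule"
    where M': "iterated_dual p n M'" "lcb_isomorphic (dual_bimodule M') M" by auto
  from Suc.IH[OF M'(1)] obtain \<iota> \<tau> where c: "coupled_bimodule p M' \<iota> \<tau>"
    "iterated_dual (unitization_seminorms p) n (unitization_bimodule M' \<iota> \<tau>)" by auto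
  from unitization_bimodule_transport[OF coupled_bimodule_dual[OF c(1)] M'(2)]
  obtain \<kappa> \<sigma> where *: "coupled_bimodule p M \<kappa> \<sigma>"
    "lcb_isomorphic
       (unitization_bimodule (dual_bimodule M') \<tau> (evaluation (lcb_topology M') \<iota>))
       (unitization_bimodule M \<kappa> \<sigma>)"
    by metis
  then show ?case
    using c(2) lcb_isomorphic_trans[OF unitization_bimodule_dual[OF c(1)] *(2)] by auto
qed

text \<open>Descending the tower. It ensures that weak amenability over \<open>'u\<close> is not
  vacuous once \<open>'u\<close> has a copy of a higher dual.\<close>

lemma iterated_dual_1_exists:
  fixes M :: "('a::complex_algebra, 'u::complex_vector) lc_bimodule"
  shows "iterated_dual p (Suc n) M \<Longrightarrow> \<exists>N :: ('a, 'u) lc_bimodule. iterated_dual p 1 N"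
proof (induction n arbitrary: M)
  case 0
  then show ?case unfolding One_nat_def by blast
next
  case (Suc n)
  then show ?case unfolding iterated_dual.simps(2)[of p "Suc n"] by blast
qed

section \<open>Derivations\<close>

text \<open>Weak amenability stated for the actual dual of the algebra, hence free of an ambient
  space and of copies.\<close>

definition derivations_into_dual_inner :: "(nat \<Rightarrow> 'a::complex_algebra \<Rightarrow> real) \<Rightarrow> bool" where
  "derivations_into_dual_inner p \<longleftrightarrow> (\<forall>D. continuous_derivation p (dual_bimodule (regular_bimodule p)) D \<longrightarrow>
     inner_derivation (dual_bimodule (regular_bimodule p)) D)"

text \<open>A copy of the first dual exists in \<open>'u\<close> because one of the n-th does;
  innerness is transferred from it to the actual dual.\<close>

lemma weakly_amenable_derivations_into_dual_inner:
  fixes p :: "nat \<Rightarrow> 'a::complex_algebra \<Rightarrow> real"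
  assumes p: "frechet_algebra p" and n: "n \<ge> 1" and ex: "has_iterated_dual TYPE('u::complex_vector) n p"
    and wa: "weakly_amenable TYPE('u) p"
  shows "derivations_into_dual_inner p"
proof -
  obtain m where m: "n = Suc m" using n by (cases n) auto
  obtain M :: "('a, 'u) lc_bimodule" where M: "iterated_dual p 1 M"
    using ex iterated_dual_1_exists unfolding has_iterated_dual_def m by blast
  then obtain M0 :: "('a, 'u) lc_bimodule" where M0: "lcb_isomorphic (regular_bimodule p) M0"
    "lcb_isomorphic (dual_bimodule M0) M" by auto
  have "lcb_isomorphic (dual_bimodule (regular_bimodule p)) (dual_bimodule M0)"
    using M0(1) lcb_iso_dual[OF _ wf_regular_bimodule[OF p]] by (auto simp: lcb_isomorphic_def)
  from lcb_isomorphic_trans[OF this M0(2)]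
  have iso: "lcb_isomorphic M (dual_bimodule (regular_bimodule p))"
    by (rule lcb_isomorphic_sym[OF _ wf_dual_bimodule[OF wf_regular_bimodule[OF p]]])
  show ?thesis
    unfolding derivations_into_dual_inner_def
    using derivations_inner_transfer[OF iso iterated_dual_wf[OF p M]] wa M
    unfolding n_weakly_amenable_def by blast
qed

lemma dual_regular_simps:
  "lcb_topology (dual_bimodule (regular_bimodule p)) = strong_topology (frechet_topology p)"
  "lact (dual_bimodule (regular_bimodule p)) b f x = f (x * b)"
  "ract (dual_bimodule (regular_bimodule p)) f b x = f (b * x)"
  by (simp_all add: dual_bimodule_def regular_bimodule_def)

lemma continuous_dual_frechetD:
  assumes "f \<in> continuous_dual (frechet_topology p)"
  shows "clinear_on UNIV f" "continuous_map (frechet_topology p) euclidean f"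
  using assms by (auto simp: continuous_dual_def)

text \<open>In the weakly amenable case apply the hypothesis to the derivation sending a to f(a) f.\<close>

lemma functional_vanishing_on_products:
  assumes p: "frechet_algebra p"
    and hyp: "derivations_into_dual_inner p \<or> has_bounded_approximate_identity p"
    and f: "f \<in> continuous_dual (frechet_topology p)" and prod: "\<And>a b. f (a * b) = 0"
  shows "f a = 0"
  using hyp
proof
  let ?T = "frechet_topology p"
  note lin = continuous_dual_frechetD(1)[OF f] and cont = continuous_dual_frechetD(2)[OF f]
  assume *: "derivations_into_dual_inner p"
  let ?D = "\<lambda>a. f a *\<^sub>C f"
  have mem: "c *\<^sub>C f \<in> continuous_dual ?T" for c
    using csubspace_setD(3)[OF csubspace_set_continuous_dual f] .
  have "continuous_map ?T (strong_topology ?T) ?D"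
    unfolding strong_topology_def
  proof (rule continuous_map_into_seminorm_topology)
    fix q f g h assume "q \<in> {dual_seminorm B |B. tvs_bounded ?T B}"
      "f \<in> continuous_dual ?T" "g \<in> continuous_dual ?T" "h \<in> continuous_dual ?T"
    then show "q (f - h) \<le> q (f - g) + q (g - h)"
      using dual_seminorm_triangle[of ?T] csubspace_UNIV by auto
  next
    fix q x and e :: real assume "q \<in> {dual_seminorm B |B. tvs_bounded ?T B}" and e: "e > 0"
    then obtain B where B: "tvs_bounded ?T B" "q = dual_seminorm B" by auto
    have q0: "0 \<le> q f" unfolding B(2) by (rule dual_seminorm_nonneg[OF B(1) f]) (simp add: csubspace_UNIV)
    define d where "d = e / (q f + 1)"
    have d: "d > 0" using e q0 by (simp add: d_def)
    let ?V = "{y \<in> topspace ?T. f y \<in> ball (f x) d}"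
    have "openin ?T ?V" by (rule openin_continuous_map_preimage[OF cont]) simp
    moreover have "x \<in> ?V" using d by simp
    moreover have "q (?D y - ?D x) < e" if y: "y \<in> ?V" for y
    proof -
      have "?D y - ?D x = (f y - f x) *\<^sub>C f" by (auto simp: scaleC_fun_def fun_eq_iff algebra_simps)
      then have "q (?D y - ?D x) \<le> cmod (f y - f x) * q f"
        unfolding B(2) using dual_seminorm_scaleC[OF B(1) f] csubspace_UNIV by simp
      also have "\<dots> \<le> d * q f"
        using y q0 by (intro mult_right_mono) (auto simp: dist_norm norm_minus_commute)
      also have "\<dots> < d * (q f + 1)" using d by simp
      also have "\<dots> = e" using q0 by (simp add: d_def)
      finally show ?thesis .
    qed
    ultimately show "\<exists>V. openin ?T V \<and> x \<in> V \<and> (\<forall>y\<in>V. q (?D y - ?D x) < e)" by blast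
  qed (rule mem)
  \<comment> \<open>Since f vanishes on products, both sides of the product rule are 0.\<close>
  then have "continuous_derivation p (dual_bimodule (regular_bimodule p)) ?D"
    using lin
    by (auto simp: continuous_derivation_def dual_regular_simps clinear_on_def scaleC_fun_def fun_eq_iff
        prod algebra_simps)
  then obtain x where x: "\<And>b. ?D b = lact (dual_bimodule (regular_bimodule p)) b x -
      ract (dual_bimodule (regular_bimodule p)) x b"
    using * by (auto simp: derivations_into_dual_inner_def inner_derivation_def)
  \<comment> \<open>At the point \<open>a\<close> the commutator is x(a a) - x(a a), so the square
    of f(a) is 0.\<close>
  have "?D a a = 0" unfolding x by (simp add: dual_regular_simps)
  then show ?thesis by (simp add: scaleC_fun_def)
next
  assume "has_bounded_approximate_identity p"
  then obtain F :: "'a filter" where F: "F \<noteq> bot" "limitin (frechet_topology p) (\<lambda>e. e * a) a F"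
    unfolding has_bounded_approximate_identity_def by auto
  have "((f \<circ> (\<lambda>e. e * a)) \<longlongrightarrow> f a) F"
    using continuous_map_limit[OF continuous_dual_frechetD(2)[OF f] F(2)] by simp
  then have "((\<lambda>e. 0) \<longlongrightarrow> f a) F" by (simp add: o_def prod)
  then show ?thesis using F(1) by (simp add: tendsto_const_iff)
qed

text \<open>Tychonoff: the families \<open>g e\<close> eventually lie in a product of closed discs,
  which is compact, so they have a cluster point there.\<close>

lemma tendsto_cluster_compact_product:
  fixes g :: "'e \<Rightarrow> 'i \<Rightarrow> complex"
  assumes F: "F \<noteq> bot" and bnd: "eventually (\<lambda>e. \<forall>i. cmod (g e i) \<le> K i) F"
  obtains G L where "G \<noteq> bot" "G \<le> F" "\<And>i. ((\<lambda>e. g e i) \<longlongrightarrow> L i) G"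
proof -
  have "compactin (product_topology (\<lambda>i. euclidean) UNIV) (PiE UNIV (\<lambda>i. cball (0 :: complex) (K i)))"
    unfolding compactin_PiE by simp
  then have "compact (PiE UNIV (\<lambda>i. cball (0 :: complex) (K i)))"
    by (simp add: euclidean_product_topology)
  moreover have "filtermap g F \<noteq> bot" using F by (simp add: filtermap_bot_iff)
  moreover have "eventually (\<lambda>x. x \<in> PiE UNIV (\<lambda>i. cball (0 :: complex) (K i))) (filtermap g F)"
    using bnd by (simp add: eventually_filtermap PiE_iff)
  ultimately obtain L where L: "inf (nhds L) (filtermap g F) \<noteq> bot"
    unfolding compact_filter by blast
  \<comment> \<open>The filter counterpart of a subnet along which \<open>g\<close> converges to the
    cluster point.\<close>
  define G where "G = inf (filtercomap g (nhds L)) F"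
  have "G \<noteq> bot"
  proof
    assume "G = bot"
    then have "eventually (\<lambda>_. False) G" by simp
    then obtain P Q where PQ: "eventually P (nhds L)" "eventually Q F" "\<And>e. P (g e) \<Longrightarrow> \<not> Q e"
      unfolding G_def eventually_inf eventually_filtercomap by blast
    have "eventually (\<lambda>x. \<not> P x) (filtermap g F)"
      unfolding eventually_filtermap using PQ(2) by eventually_elim (use PQ(3) in blast)
    then have "eventually (\<lambda>_. False) (inf (nhds L) (filtermap g F))"
      unfolding eventually_inf using PQ(1) by blast
    then show False using L by (simp add: trivial_limit_def)
  qed
  moreover have "G \<le> F" by (simp add: G_def)
  moreover have "((\<lambda>e. g e i) \<longlongrightarrow> L i) G" for i
  proof -
    have "filterlim g (nhds L) G"
      unfolding filterlim_def G_def
      by (meson filtermap_filtercomap filtermap_mono inf_le1 order_trans)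
    then have "limitin (product_topology (\<lambda>i. euclidean) UNIV) g L G"
      by (simp add: euclidean_product_topology)
    then show ?thesis unfolding limitin_componentwise by simp
  qed
  ultimately show ?thesis using that by blast
qed

section \<open>Derivations into a coupled bimodule and their extension to the unitization\<close>

context coupled_bimodule
begin

lemma tau_continuous:
  assumes "tvs_bounded (lcb_topology M) {x}"
  shows "(\<lambda>a. \<tau> a x) \<in> continuous_dual (frechet_topology p)"
proof -
  have lin: "clinear_on UNIV (\<lambda>a. \<tau> a x)"
    using tau_linear by (auto simp: clinear_on_def scaleC_fun_def)
  moreover have "continuous_map (frechet_topology p) euclidean (\<lambda>a. \<tau> a x)"
    by (rule frechet_continuous_functional[OF frechet lin]) (use tau_bounded[OF _ assms] in blast)
  ultimately show ?thesis by (simp add: continuous_dual_def)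
qed

context
  fixes D
  assumes D: "continuous_derivation p M D"
begin

lemma derivation_space: "D a \<in> lcb_space M"
  using D by (auto simp: continuous_derivation_def continuous_map_def)

lemma derivation_linear: "clinear_on UNIV D"
  using D by (simp add: continuous_derivation_def)

lemma derivation_mult: "D (a * b) = lact M a (D b) + ract M (D a) b"
  using D by (simp add: continuous_derivation_def)

lemma derivation_bounded:
  "tvs_bounded (frechet_topology p) B \<Longrightarrow> tvs_bounded (lcb_topology M) (D ` B)"
  by (rule tvs_bounded_image) (use D in \<open>auto simp: continuous_derivation_def csubspace_UNIV\<close>)

lemma derivation_tau_dual: "(\<lambda>b. \<tau> b (D a)) \<in> continuous_dual (frechet_topology p)"
  using tau_continuous derivation_bounded[OF tvs_bounded_frechet_singleton[OF frechet, of a]] by simp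

lemma tau_derivation_linear: "clinear_on UNIV (\<lambda>a. \<tau> b (D a))"
  using derivation_linear derivation_space
  by (auto simp: clinear_on_def clinear_onD[OF tau_clinear])

text \<open>This is the product rule, evaluated at \<open>c\<close>, for the map that sends
  \<open>a\<close> to the functional \<lambda>c. \<open>\<tau> c (D a)\<close> in the dual of
  A.\<close>

lemma tau_derivation_mult: "\<tau> c (D (a * b)) = \<tau> (c * a) (D b) + \<tau> (b * c) (D a)"
  by (simp add: derivation_mult clinear_onD[OF tau_clinear] derivation_space
      wf_bimoduleD(6,7)[OF wf] tau_act)

text \<open>The preimage under D of the equicontinuity neighbourhood contains a ball of a single
  seminorm. The bound is uniform over \<open>B\<close>, as strong continuity and the compactness
  argument both require.\<close>

lemma tau_derivation_bound:
  assumes B: "tvs_bounded (frechet_topology p) B"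
  obtains C l where "C > 0" "\<And>b a. b \<in> B \<Longrightarrow> cmod (\<tau> b (D a)) \<le> C * p l a"
proof -
  obtain U where U: "openin (lcb_topology M) U" "0 \<in> U" "\<And>x b. x \<in> U \<Longrightarrow> b \<in> B \<Longrightarrow> cmod (\<tau> b x) \<le> 1"
    using tau_equicontinuous[OF B] by blast
  have "openin (frechet_topology p) {a \<in> UNIV. D a \<in> U}"
    using D U(1) by (auto simp: continuous_derivation_def continuous_map_def)
  moreover have "D 0 = 0" by (rule clinear_on_zero[OF derivation_linear csubspace_UNIV])
  ultimately obtain l r where r: "r > 0" "{y. p l y < r} \<subseteq> {a \<in> UNIV. D a \<in> U}"
    using U(2) by (auto intro: frechet_nhd_base[OF frechet, of "{a \<in> UNIV. D a \<in> U}"])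
  have "cmod (\<tau> b (D a)) \<le> (2 / r) * p l a" if "b \<in> B" for a b
    by (rule seminorm_bound_from_nhd)
      (use frechet_algebraD[OF frechet] clinear_onD[OF tau_derivation_linear] U(3) r that
        in \<open>auto simp: norm_mult\<close>)
  moreover have "2 / r > 0" using r(1) by simp
  ultimately show ?thesis by (rule that[rotated])
qed

text \<open>If derivations into the first dual are inner, then \<open>\<lambda>a b. \<tau> b (D a)\<close> is inner and \<open>d = 0\<close> works,
  because the symmetrization of an inner derivation vanishes. With a bounded approximate identity,
  d is a cluster point of the functionals \<open>\<lambda>a. \<tau> e (D a)\<close> along it.\<close>

lemma symmetrizing_functional:
  assumes hyp: "derivations_into_dual_inner p \<or> has_bounded_approximate_identity p"
  obtains d where "d \<in> continuous_dual (frechet_topology p)"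
    "\<And>a b. d (a * b) = \<tau> a (D b) + \<tau> b (D a)"
  using hyp
proof
  let ?T = "frechet_topology p"
  assume *: "derivations_into_dual_inner p"
  let ?D = "\<lambda>a b. \<tau> b (D a)"
  have "continuous_map ?T (strong_topology ?T) ?D"
    unfolding strong_topology_def frechet_topology_def[of p]
  proof (rule continuous_map_seminorm_topology; (fold frechet_topology_def)?)
    fix q f g h assume "q \<in> {dual_seminorm B |B. tvs_bounded ?T B}"
      "f \<in> continuous_dual ?T" "g \<in> continuous_dual ?T" "h \<in> continuous_dual ?T"
    then show "q (f - h) \<le> q (f - g) + q (g - h)"
      using dual_seminorm_triangle[of ?T] csubspace_UNIV by auto
  next
    fix q assume "q \<in> {dual_seminorm B |B. tvs_bounded ?T B}"
    then obtain B where B: "tvs_bounded ?T B" "q = dual_seminorm B" by auto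
    obtain C l where C: "C > 0" "\<And>b a. b \<in> B \<Longrightarrow> cmod (\<tau> b (D a)) \<le> C * p l a"
      by (rule tau_derivation_bound[OF B(1)]) blast
    have "q (?D x - ?D y) \<le> C * p l (x - y)" for x y
      unfolding B(2)
    proof (rule dual_seminorm_least)
      fix b assume b: "b \<in> B"
      have "(?D x - ?D y) b = \<tau> b (D (x - y))"
        using clinear_on_diff[OF tau_derivation_linear csubspace_UNIV, of x y b] by simp
      then show "cmod ((?D x - ?D y) b) \<le> C * p l (x - y)" using C(2)[OF b] by simp
    next
      show "(?D x - ?D y) 0 = 0"
        by (simp add: clinear_on_zero[OF tau_linear csubspace_UNIV])
    qed (use C(1) frechet_algebraD(6)[OF frechet] in simp)
    then show "\<exists>q'\<in>range p. \<exists>C>0. \<forall>x\<in>UNIV. \<forall>y\<in>UNIV. q (?D x - ?D y) \<le> C * q' (x - y)"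
      using C(1) by blast
  qed (use derivation_tau_dual frechet_algebraD(5)[OF frechet] in auto)
  moreover have "clinear_on UNIV ?D"
    using clinear_onD[OF tau_derivation_linear] by (auto simp: clinear_on_def fun_eq_iff scaleC_fun_def)
  moreover have "?D (a * b) = lact (dual_bimodule (regular_bimodule p)) a (?D b) +
      ract (dual_bimodule (regular_bimodule p)) (?D a) b" for a b
    by (auto simp: dual_regular_simps fun_eq_iff tau_derivation_mult)
  ultimately have "continuous_derivation p (dual_bimodule (regular_bimodule p)) ?D"
    by (simp add: continuous_derivation_def dual_regular_simps(1))
  then obtain x where x: "\<And>b. ?D b = lact (dual_bimodule (regular_bimodule p)) b x -
      ract (dual_bimodule (regular_bimodule p)) x b"
    using * by (auto simp: derivations_into_dual_inner_def inner_derivation_def)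
  have "\<tau> a (D b) = x (a * b) - x (b * a)" for a b
    using fun_cong[OF x[of b], of a] by (simp add: dual_regular_simps)
  then show ?thesis using that[of 0] by simp
next
  let ?T = "frechet_topology p"
  assume "has_bounded_approximate_identity p"
  then obtain F :: "'a filter" and B where F: "F \<noteq> bot" "tvs_bounded ?T B" "eventually (\<lambda>e. e \<in> B) F"
    and lim: "\<And>a. limitin ?T (\<lambda>e. e * a) a F" "\<And>a. limitin ?T (\<lambda>e. a * e) a F"
    unfolding has_bounded_approximate_identity_def by auto
  obtain C l where C: "C > 0" "\<And>b a. b \<in> B \<Longrightarrow> cmod (\<tau> b (D a)) \<le> C * p l a"
    by (rule tau_derivation_bound[OF F(2)]) blast
  have "eventually (\<lambda>e. \<forall>a. cmod (\<tau> e (D a)) \<le> C * p l a) F"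
    using F(3) by eventually_elim (use C(2) in blast)
  then obtain G d where G: "G \<noteq> bot" "G \<le> F" and d: "\<And>a. ((\<lambda>e. \<tau> e (D a)) \<longlongrightarrow> d a) G"
    by (rule tendsto_cluster_compact_product[OF F(1)]) blast
  have "d (a + b) = d a + d b" for a b
    by (rule tendsto_unique[OF G(1) d])
      (use tendsto_add[OF d[of a] d[of b]] in \<open>simp add: clinear_onD(1)[OF tau_derivation_linear]\<close>)
  moreover have "d (c *\<^sub>C a) = c * d a" for c a
    by (rule tendsto_unique[OF G(1) d])
      (use tendsto_mult_left[OF d[of a], of c] in \<open>simp add: clinear_onD(2)[OF tau_derivation_linear]\<close>)
  ultimately have lin: "clinear_on UNIV d" by (simp add: clinear_on_def)
  moreover have "continuous_map ?T euclidean d"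
  proof (rule frechet_continuous_functional[OF frechet lin])
    fix B' assume "tvs_bounded ?T B'"
    then obtain K where K: "\<And>b a. b \<in> B \<Longrightarrow> a \<in> B' \<Longrightarrow> cmod (\<tau> b (D a)) \<le> K"
      using tau_bounded[OF F(2) derivation_bounded] by blast
    have "cmod (d a) \<le> K" if "a \<in> B'" for a
    proof (rule Lim_norm_ubound[OF G(1) d])
      have "eventually (\<lambda>e. e \<in> B) G" using F(3) G(2) by (simp add: le_filter_def)
      then show "eventually (\<lambda>e. cmod (\<tau> e (D a)) \<le> K) G"
        by eventually_elim (rule K[OF _ that])
    qed
    then show "\<exists>K. \<forall>a\<in>B'. cmod (d a) \<le> K" by blast
  qed
  \<comment> \<open>With \<open>c\<close> = e, \<open>tau_derivation_mult\<close> gives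
    \<open>\<tau> (e * a) (D b) + \<tau> (b * e) (D a)\<close>, and both products converge along the
    approximate identity.\<close>
  moreover have "d (a * b) = \<tau> a (D b) + \<tau> b (D a)" for a b
  proof (rule tendsto_unique[OF G(1) d])
    have "((\<lambda>e. \<tau> (e * a) (D b)) \<longlongrightarrow> \<tau> a (D b)) F"
      using continuous_map_limit[OF continuous_dual_frechetD(2)[OF derivation_tau_dual] lim(1)]
      by (simp add: o_def)
    moreover have "((\<lambda>e. \<tau> (b * e) (D a)) \<longlongrightarrow> \<tau> b (D a)) F"
      using continuous_map_limit[OF continuous_dual_frechetD(2)[OF derivation_tau_dual] lim(2)]
      by (simp add: o_def)
    ultimately have "((\<lambda>e. \<tau> e (D (a * b))) \<longlongrightarrow> \<tau> a (D b) + \<tau> b (D a)) F"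
      unfolding tau_derivation_mult by (rule tendsto_add)
    then show "((\<lambda>e. \<tau> e (D (a * b))) \<longlongrightarrow> \<tau> a (D b) + \<tau> b (D a)) G"
      by (rule tendsto_mono[OF G(2)])
  qed
  ultimately show ?thesis using that[of d] by (simp add: continuous_dual_def)
qed

end

text \<open>Here n no longer occurs: only the coupling matters, and its parity enters through
  \<open>alternative\<close>.\<close>

lemma derivations_inner_unitization_iff:
  assumes hyp: "derivations_into_dual_inner p \<or> has_bounded_approximate_identity p"
  shows "(\<forall>D. continuous_derivation (unitization_seminorms p) (unitization_bimodule M \<iota> \<tau>) D \<longrightarrow>
      inner_derivation (unitization_bimodule M \<iota> \<tau>) D) \<longleftrightarrow>
    (\<forall>D. continuous_derivation p M D \<longrightarrow> inner_derivation M D)"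
    (is "?lhs \<longleftrightarrow> ?rhs")
proof
  let ?T = "frechet_topology p" and ?N = "unitization_bimodule M \<iota> \<tau>"
  let ?T' = "frechet_topology (unitization_seminorms p)"
  assume lhs: ?lhs
  show ?rhs
  proof (intro allI impI)
    fix D assume D: "continuous_derivation p M D"
    note Ds = derivation_space[OF D] and Dm = derivation_mult[OF D]
    \<comment> \<open>The second condition is the scalar coordinate of the product rule; the third
      removes the \<iota> terms from the first coordinate. If \<iota> is nonzero, then \<tau> = 0
      and d = 0 satisfies both.\<close>
    obtain d where d: "d \<in> continuous_dual ?T" "\<And>a b. d (a * b) = \<tau> a (D b) + \<tau> b (D a)"
      "\<And>a b. d a *\<^sub>C \<iota> b = 0"
    proof (cases "\<forall>a. \<iota> a = 0")
      case True
      then show ?thesis using symmetrizing_functional[OF D hyp] that by (metis scaleC_zero_right)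
    next
      case False
      then show ?thesis using alternative that[of 0] by (auto simp: fun_eq_iff)
    qed
    let ?E = "\<lambda>x. (D (algebra_part x), d (algebra_part x))"
    have alg: "continuous_map ?T' ?T algebra_part" by (rule continuous_map_algebra_part[OF frechet])
    have "continuous_map ?T' (lcb_topology M) (D \<circ> algebra_part)"
      using D by (intro continuous_map_compose[OF alg]) (simp add: continuous_derivation_def)
    moreover have "continuous_map ?T' euclidean (d \<circ> algebra_part)"
      by (intro continuous_map_compose[OF alg] continuous_dual_frechetD(2)[OF d(1)])
    ultimately have "continuous_map ?T' (lcb_topology ?N) ?E"
      unfolding unitization_bimodule_simps by (auto simp: o_def intro: continuous_map_pairedI)
    moreover have "clinear_on UNIV ?E"
      using clinear_onD[OF derivation_linear[OF D]] clinear_onD[OF continuous_dual_frechetD(1)[OF d(1)]]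
      by (auto simp: clinear_on_def plus_unitization_def scaleC_unitization_def scaleC_prod_def)
    moreover have "?E (x * y) = lact ?N x (?E y) + ract ?N (?E x) y" for x y
      using clinear_onD[OF derivation_linear[OF D]] clinear_onD[OF continuous_dual_frechetD(1)[OF d(1)]]
      by (simp add: times_unitization_def unitization_bimodule_simps d(2,3) Dm add_ac)
    ultimately have "continuous_derivation (unitization_seminorms p) ?N ?E"
      by (simp add: continuous_derivation_def)
    then obtain z where z: "z \<in> lcb_space ?N" "\<And>b. ?E b = lact ?N b z - ract ?N z b"
      using lhs by (auto simp: inner_derivation_def)
    \<comment> \<open>The term \<open>snd z *\<^sub>C \<iota> a\<close> occurs in both actions and
      cancels in the commutator.\<close>
    have "D a = lact M a (fst z) - ract M (fst z) a" for a
      using z(2)[of "Unitization a 0"] by (simp add: unitization_bimodule_simps)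
    moreover have "fst z \<in> lcb_space M" using z(1) by (auto simp: unitization_bimodule_simps)
    ultimately show "inner_derivation M D" by (auto simp: inner_derivation_def)
  qed
next
  let ?T = "frechet_topology p" and ?N = "unitization_bimodule M \<iota> \<tau>"
  let ?T' = "frechet_topology (unitization_seminorms p)"
  assume rhs: ?rhs
  show ?lhs
  proof (intro allI impI)
    fix D assume D: "continuous_derivation (unitization_seminorms p) ?N D"
    have Dl: "clinear_on UNIV D" and Dc: "continuous_map ?T' (lcb_topology ?N) D"
      and Dm: "\<And>x y. D (x * y) = lact ?N x (D y) + ract ?N (D x) y"
      using D by (auto simp: continuous_derivation_def)
    define E where "E = (\<lambda>a. fst (D (Unitization a 0)))"
    define d where "d = (\<lambda>a. snd (D (Unitization a 0)))"
    have "continuous_map ?T (prod_topology (lcb_topology M) euclidean) (D \<circ> (\<lambda>a. Unitization a 0))"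
      using Dc by (intro continuous_map_compose[OF continuous_map_Unitization[OF frechet]])
        (simp add: unitization_bimodule_simps)
    then have Ec: "continuous_map ?T (lcb_topology M) E" and dc: "continuous_map ?T euclidean d"
      using continuous_map_fst_of continuous_map_snd_of by (fastforce simp: E_def d_def o_def)+
    have incl: "Unitization (a + b) 0 = Unitization a 0 + Unitization b 0"
      "Unitization (c *\<^sub>C a) 0 = c *\<^sub>C Unitization a 0"
      "Unitization (a * b) 0 = Unitization a 0 * Unitization b 0" for a b :: 'a and c
      by (simp_all add: plus_unitization_def scaleC_unitization_def times_unitization_def)
    have El: "clinear_on UNIV E" and dl: "clinear_on UNIV d"
      using clinear_onD[OF Dl] by (auto simp: clinear_on_def E_def d_def incl scaleC_prod_def)
    have Em: "E (a * b) = lact M a (E b) + ract M (E a) b + (d b *\<^sub>C \<iota> a + d a *\<^sub>C \<iota> b)"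
      and dm: "d (a * b) = \<tau> a (E b) + \<tau> b (E a)" for a b
      unfolding E_def d_def incl Dm by (simp_all add: unitization_bimodule_simps algebra_simps)
    have Es: "E a \<in> lcb_space M" for a using Ec by (auto simp: continuous_map_def)
    have ddual: "d \<in> continuous_dual ?T" using dc dl by (simp add: continuous_dual_def)
    have derivation: "continuous_derivation p M E" if "\<And>a b. d b *\<^sub>C \<iota> a + d a *\<^sub>C \<iota> b = 0"
      using El Ec Em that by (simp add: continuous_derivation_def)
    obtain x where x: "x \<in> lcb_space M" "\<And>a. E a = lact M a x - ract M x a" and d0: "\<And>a. d a = 0"
    \<comment> \<open>The order depends on the case: if \<iota> = 0, E is already a derivation, and
      its innerness forces d = 0; otherwise \<tau> = 0 forces d = 0, which then makes E a
      derivation.\<close>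
    proof (cases "\<forall>a. \<iota> a = 0")
      case True
      then have "inner_derivation M E" using rhs derivation by simp
      then obtain x where x: "x \<in> lcb_space M" "\<And>a. E a = lact M a x - ract M x a"
        by (auto simp: inner_derivation_def)
      have "\<tau> a (E b) = \<tau> (a * b) x - \<tau> (b * a) x" for a b
        by (simp add: x clinear_on_diff[OF tau_clinear space] wf_bimoduleD(6,7)[OF wf] tau_act)
      then have "d (a * b) = 0" for a b by (simp add: dm)
      then have "d a = 0" for a by (rule functional_vanishing_on_products[OF frechet hyp ddual])
      then show ?thesis using that x by blast
    next
      case False
      then have "d (a * b) = 0" for a b using alternative by (auto simp: dm)
      then have d0: "d a = 0" for a by (rule functional_vanishing_on_products[OF frechet hyp ddual])
      then have "inner_derivation M E" using rhs derivation by simp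
      then show ?thesis using that d0 by (auto simp: inner_derivation_def)
    qed
    have space_N: "D x \<in> lcb_space M \<times> UNIV" for x
      using Dc by (auto simp: continuous_map_def unitization_bimodule_simps)
    \<comment> \<open>The identity acts trivially on both sides, so the product rule for 1 * 1 reads
      D 1 = D 1 + D 1.\<close>
    have "lact ?N 1 (D 1) = D 1" "ract ?N (D 1) 1 = D 1"
      using space_N[of 1] clinear_on_zero[OF iota_linear csubspace_UNIV]
        clinear_on_zero[OF tau_linear csubspace_UNIV]
      by (auto simp: unitization_bimodule_simps one_unitization_def zero_act prod_eq_iff)
    then have D1: "D 1 = 0" using Dm[of 1 1] by simp
    \<comment> \<open>Any scalar coordinate would cancel in the commutator; 0 is chosen. The \<tau>
      terms cancel too, matching d = 0.\<close>
    have "D y = lact ?N y (x, 0) - ract ?N (x, 0) y" for y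
    proof -
      have "y = Unitization (algebra_part y) 0 + scalar_part y *\<^sub>C 1"
        by (simp add: plus_unitization_def scaleC_unitization_def one_unitization_def)
      then have "D y = D (Unitization (algebra_part y) 0)"
        using clinear_onD[OF Dl] by (metis D1 UNIV_I add.right_neutral scaleC_zero_right)
      also have "\<dots> = (E (algebra_part y), d (algebra_part y))" by (simp add: E_def d_def)
      finally show ?thesis by (simp add: unitization_bimodule_simps x(2) d0)
    qed
    moreover have "(x, 0) \<in> lcb_space ?N" using x(1) by (simp add: unitization_bimodule_simps)
    ultimately show "inner_derivation ?N D" by (auto simp: inner_derivation_def)
  qed
qed

end

theorem theorem3p20:
  fixes p :: "nat \<Rightarrow> 'a::complex_algebra \<Rightarrow> real" and n :: nat
  assumes "frechet_algebra p"
    and "n \<ge> 1"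
    and "has_iterated_dual TYPE('u::complex_vector) n p"
    and "has_iterated_dual TYPE('u) n (unitization_seminorms p)"
    and "weakly_amenable TYPE('u) p \<or> has_bounded_approximate_identity p"
  shows "n_weakly_amenable TYPE('u) n (unitization_seminorms p) \<longleftrightarrow> n_weakly_amenable TYPE('u) n p"
proof -
  let ?q = "unitization_seminorms p"
  note p = assms(1) and q = frechet_algebra_unitization[OF assms(1)]
  obtain M :: "('a, 'u) lc_bimodule" where M: "iterated_dual p n M"
    using assms(3) by (auto simp: has_iterated_dual_def)
  obtain \<iota> \<tau> where c: "coupled_bimodule p M \<iota> \<tau>"
    and N: "iterated_dual ?q n (unitization_bimodule M \<iota> \<tau>)"
    using iterated_dual_unitization[OF p M] by blast
  \<comment> \<open>The constructed copy lives in \<open>'u \<times> complex\<close>, while the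
    claim concerns \<open>'u\<close>; independence of the ambient space bridges the two.\<close>
  have "has_iterated_dual TYPE('u \<times> complex) n ?q"
    using N unfolding has_iterated_dual_def by blast
  then have "n_weakly_amenable TYPE('u) n ?q \<longleftrightarrow> n_weakly_amenable TYPE('u \<times> complex) n ?q"
    by (rule n_weakly_amenable_ambient_cong[OF q assms(4)])
  moreover have "derivations_into_dual_inner p \<or> has_bounded_approximate_identity p"
    using assms(5) weakly_amenable_derivations_into_dual_inner[OF assms(1-3)] by blast
  ultimately show ?thesis
    unfolding n_weakly_amenable_iff[OF q N] n_weakly_amenable_iff[OF p M]
    using coupled_bimodule.derivations_inner_unitization_iff[OF c] by blast
qed

end
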